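(* Let $S$ be a finite set with $q\ge2$ elements, $X=S^{\mathbb N}$ with shift $T$. Let $\Theta:\Omega\to\Omega$ be a uniquely ergodic topological dynamical system, let $h\in C(\Omega)$ be a real-valued continuous function, and let $f:X\to\mathbb R$ be a function depending only on a finite number of coordinates. Then for every $\omega\in\Omega$ and every $\lambda\in\mathbb R$ the limit $$\phi(\lambda)=\lim_{n\to\infty}\frac1n\log\int_X\exp\Big(\lambda\sum_{k=0}^{n-1}h(\Theta^k\omega)f(T^kx)\Big)\,d\sigma(x)$$ exists; the function $\phi$ is independent of $\omega$, and it is a real-analytic function of $\lambda\in\mathbb R$.
   Context: Points of $X$ are sequences $x=(x_n)_{n\ge0}$ and $(Tx)_n=x_{n+1}$. $\sigma$ is the uniform Bernoulli measure on $X$, giving mass $q^{-n}$ to each cylinder $\{y:y_k=x_k,\ 0\le k<n\}$. A uniquely ergodic topological dynamical system is a continuous map $\Theta$ of a compact metric space $\Omega$ having exactly one invariant Borel probability measure. *)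

theory Defs
  imports "HOL-Probability.Probability"
begin

definition shift_map :: "(nat \<Rightarrow> 's) \<Rightarrow> nat \<Rightarrow> 's" where
  "shift_map x = (\<lambda>n. x (Suc n))"

definition uniform_bernoulli :: "'s set \<Rightarrow> (nat \<Rightarrow> 's) measure" where
  "uniform_bernoulli S = (\<Pi>\<^sub>M n\<in>UNIV. uniform_count_measure S)"

lemma space_uniform_bernoulli: "space (uniform_bernoulli S) = UNIV \<rightarrow> S"
  by (auto simp: uniform_bernoulli_def space_PiM space_uniform_count_measure PiE_UNIV_domain)

lemma measure_uniform_bernoulli_cylinder:
  assumes S: "finite S" and x: "x \<in> UNIV \<rightarrow> S"
  shows "measure (uniform_bernoulli S) {y \<in> UNIV \<rightarrow> S. \<forall>k<n. y k = x k} = 1 / real (card S) ^ n"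
proof -
  have "S \<noteq> {}" using x by auto
  interpret P: product_prob_space "\<lambda>_. uniform_count_measure S" "UNIV :: nat set"
    using prob_space_uniform_count_measure[OF S \<open>S \<noteq> {}\<close>]
    by (simp add: product_prob_space_def product_prob_space_axioms_def product_sigma_finite_def
        prob_space_imp_sigma_finite)
  have "{y \<in> UNIV \<rightarrow> S. \<forall>k<n. y k = x k}
      = prod_emb UNIV (\<lambda>_. uniform_count_measure S) {..<n} (\<Pi>\<^sub>E k\<in>{..<n}. {x k})"
    by (auto simp: prod_emb_def space_uniform_count_measure PiE_iff restrict_def extensional_def)
  also have "measure (uniform_bernoulli S) \<dots> = (\<Prod>k<n. measure (uniform_count_measure S) {x k})"
    unfolding uniform_bernoulli_def using x
    by (subst P.measure_PiM_emb) (auto simp: sets_uniform_count_measure)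
  also have "\<dots> = 1 / real (card S) ^ n"
    using x S by (subst measure_uniform_count_measure) (auto simp: power_divide)
  finally show ?thesis .
qed

definition depends_on_finitely_many_coordinates :: "'s set \<Rightarrow> ((nat \<Rightarrow> 's) \<Rightarrow> real) \<Rightarrow> bool" where
  "depends_on_finitely_many_coordinates S f \<longleftrightarrow>
    (\<exists>J. finite J \<and> (\<forall>x \<in> UNIV \<rightarrow> S. \<forall>y \<in> UNIV \<rightarrow> S. (\<forall>j\<in>J. x j = y j) \<longrightarrow> f x = f y))"

text \<open>Measures live on the Borel sets of the carrier only, so that measures on it are equal iff they
  agree there, and uniqueness below is not affected by points outside it. The push-forward is the
  intended one because a continuous self-map of the carrier is measurable for these sets.\<close>

definition invariant_prob :: "'a::metric_space set \<Rightarrow> ('a \<Rightarrow> 'a) \<Rightarrow> 'a measure \<Rightarrow> bool" where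
  "invariant_prob \<Omega> \<Theta> \<mu> \<longleftrightarrow>
    sets \<mu> = sets (restrict_space borel \<Omega>) \<and> prob_space \<mu> \<and> distr \<mu> \<mu> \<Theta> = \<mu>"

definition uniquely_ergodic :: "'a::metric_space set \<Rightarrow> ('a \<Rightarrow> 'a) \<Rightarrow> bool" where
  "uniquely_ergodic \<Omega> \<Theta> \<longleftrightarrow>
    compact \<Omega> \<and> \<Theta> \<in> \<Omega> \<rightarrow> \<Omega> \<and> continuous_on \<Omega> \<Theta> \<and> (\<exists>!\<mu>. invariant_prob \<Omega> \<Theta> \<mu>)"

definition real_analytic :: "(real \<Rightarrow> real) \<Rightarrow> bool" where
  "real_analytic g \<longleftrightarrow>
    (\<forall>a. \<exists>r>0. \<exists>c. \<forall>t. \<bar>t - a\<bar> < r \<longrightarrow> (\<lambda>n. c n * (t - a) ^ n) sums g t)"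

end

(* Write Z_n(l) for the integral. For real l, log Z_n is an almost additive cocycle over the dynamics on
   Omega, because words far apart are independent; comparing it with Birkhoff sums of its own
   continuous blocks, unique ergodicity yields the limit, independent of omega.

   For analyticity, the coordinates are grouped into blocks, which expresses Z_n through products
   of positive matrices with entries exp(l * a). For complex l near a real l0, the ratio of the
   complex to the real iterate evolves by a stochastic kernel with uniform contraction, up to a
   small perturbation, so that it stays nearly constant and Z_n(l) has no zero in a disc around l0
   that does not depend on n. Hence the n-th roots of Z_n form a normal family there, and the
   modulus of a limit is exp(phi). *)

theory Submission
  imports Defs "HOL-Complex_Analysis.Complex_Analysis"
begin

text \<open>Pointwise limits of analytic functions on the real line need not be analytic, so one
  complex disc has to serve every n. For a single matrix, perturbation theory of the leading
  eigenvalue would supply it; here the matrices vary along the orbit of \<omega>, and there is no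
  eigenvalue to follow. A crude bound on a product of n perturbed matrices fails as well, since
  relative errors of fixed size compound with n. The way out is to control only the oscillation of
  the ratio, measured against its smallest modulus: scalar growth drops out, and the contraction
  gained at each step pays for the new error.

  For the Birkhoff averages, weak limits of empirical measures on \<Omega> are needed. They come
  from the real line through a coding that is itself discontinuous; only its inverse extends
  continuously, which suffices because test functions are pulled back along that inverse.\<close>

section \<open>Zero-freeness of perturbed positive matrix products\<close>

text \<open>Doeblin's argument: after removal of the common part \<open>k * Q\<close>, the rest
  \<open>P - k * Q\<close> is nonnegative of mass \<open>1 - k\<close>. Pairing it with
  \<open>Q\<close> writes the difference of the two averages as an integral of
  \<open>g b - g b'\<close> against a product measure of mass \<open>1 - k\<close>.\<close>

lemma stochastic_kernel_contraction:
  fixes P Q :: "'b \<Rightarrow> real" and g :: "'b \<Rightarrow> complex"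
  assumes P: "sum P B = 1" and Q: "sum Q B = 1"
    and Q0: "\<And>b. b \<in> B \<Longrightarrow> 0 \<le> Q b"
    and PQ: "\<And>b. b \<in> B \<Longrightarrow> k * Q b \<le> P b"
    and g: "\<And>b b'. b \<in> B \<Longrightarrow> b' \<in> B \<Longrightarrow> norm (g b - g b') \<le> d"
  shows "norm ((\<Sum>b\<in>B. of_real (P b) * g b) - (\<Sum>b\<in>B. of_real (Q b) * g b)) \<le> (1 - k) * d"
proof -
  let ?D = "\<lambda>b. P b - k * Q b"
  have D: "sum ?D B = 1 - k"
    using P Q by (simp add: sum_subtractf flip: sum_distrib_left)
  have "(\<Sum>b\<in>B. \<Sum>b'\<in>B. of_real (?D b) * of_real (Q b') * (g b - g b'))
      = (\<Sum>b\<in>B. \<Sum>b'\<in>B. (of_real (?D b) * g b) * of_real (Q b'))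
        - (\<Sum>b\<in>B. \<Sum>b'\<in>B. of_real (?D b) * (of_real (Q b') * g b'))"
    by (simp add: sum_subtractf[symmetric] algebra_simps)
  also have "\<dots> = (\<Sum>b\<in>B. of_real (?D b) * g b) * of_real (sum Q B)
        - of_real (sum ?D B) * (\<Sum>b\<in>B. of_real (Q b) * g b)"
    by (simp only: of_real_sum sum_product)
  also have "\<dots> = (\<Sum>b\<in>B. of_real (?D b) * g b) - (1 - of_real k) * (\<Sum>b\<in>B. of_real (Q b) * g b)"
    by (simp only: D Q) simp
  also have "(\<Sum>b\<in>B. of_real (?D b) * g b)
      = (\<Sum>b\<in>B. of_real (P b) * g b) - of_real k * (\<Sum>b\<in>B. of_real (Q b) * g b)"
    by (simp add: sum_subtractf sum_distrib_left algebra_simps)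
  finally have "(\<Sum>b\<in>B. of_real (P b) * g b) - (\<Sum>b\<in>B. of_real (Q b) * g b)
      = (\<Sum>b\<in>B. \<Sum>b'\<in>B. of_real (?D b) * of_real (Q b') * (g b - g b'))"
    by (simp add: algebra_simps)
  also have "norm \<dots> \<le> (\<Sum>b\<in>B. \<Sum>b'\<in>B. ?D b * Q b' * d)"
  proof (intro sum_norm_le)
    fix b b' assume b: "b \<in> B" "b' \<in> B"
    then have "0 \<le> ?D b" "0 \<le> Q b'" using PQ Q0 by auto
    then show "norm (of_real (?D b) * of_real (Q b') * (g b - g b')) \<le> ?D b * Q b' * d"
      using g[OF b] by (simp only: norm_mult norm_of_real abs_of_nonneg mult_left_mono mult_nonneg_nonneg)
  qed
  also have "\<dots> = sum ?D B * sum Q B * d"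
    by (simp add: sum_product flip: sum_distrib_right)
  also have "\<dots> = (1 - k) * d" by (simp only: D Q mult_1_right)
  finally show ?thesis .
qed

text \<open>The oscillation is compared with every \<open>R x\<close>, hence with the smallest
  modulus. This makes the condition invariant under nonzero scalar factors; nonvanishing is demanded
  separately because the zero function would satisfy the inequality.\<close>

definition pinched :: "real \<Rightarrow> 'b set \<Rightarrow> ('b \<Rightarrow> complex) \<Rightarrow> bool" where
  "pinched \<eta> B R \<longleftrightarrow> (\<forall>x\<in>B. R x \<noteq> 0 \<and> (\<forall>y\<in>B. \<forall>z\<in>B. norm (R y - R z) \<le> \<eta> * norm (R x)))"

text \<open>All values lie in a disc about one of them, \<open>R x\<close>, of radius less than its
  modulus. Such a disc is convex and omits 0, so a positive combination cannot cancel.\<close>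

lemma weighted_sum_pinched_nonzero:
  fixes u :: "'b \<Rightarrow> real"
  assumes B: "finite B" "B \<noteq> {}" and u: "\<And>b. b \<in> B \<Longrightarrow> 0 < u b"
    and R: "pinched \<eta> B R" and \<eta>: "\<eta> < 1"
  shows "(\<Sum>b\<in>B. of_real (u b) * R b) \<noteq> 0"
proof
  assume eq: "(\<Sum>b\<in>B. of_real (u b) * R b) = 0"
  obtain x where x: "x \<in> B" using B by auto
  have U: "0 < sum u B" using B u by (intro sum_pos) auto
  have Rx: "norm (R x) > 0" using R x by (auto simp: pinched_def)
  have "norm (of_real (sum u B) * R x - (\<Sum>b\<in>B. of_real (u b) * R b))
      = norm (\<Sum>b\<in>B. of_real (u b) * (R x - R b))"
    by (simp add: sum_subtractf sum_distrib_right right_diff_distrib)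
  also have "\<dots> \<le> (\<Sum>b\<in>B. u b * (\<eta> * norm (R x)))"
  proof (intro sum_norm_le)
    fix b assume "b \<in> B"
    then show "norm (of_real (u b) * (R x - R b)) \<le> u b * (\<eta> * norm (R x))"
      using u[of b] R x by (auto simp: norm_mult pinched_def intro!: mult_left_mono)
  qed
  also have "\<dots> = sum u B * (\<eta> * norm (R x))" by (simp only: sum_distrib_right)
  also have "\<dots> < sum u B * norm (R x)" using U Rx \<eta> by simp
  finally have "norm (of_real (sum u B) * R x) < sum u B * norm (R x)" by (simp only: eq diff_0_right)
  then show False using U by (simp only: norm_mult norm_of_real)
qed

text \<open>Averaging shrinks the oscillation by the factor \<open>1 - k\<close>, while the errors
  \<open>e\<close> enlarge it and also lower the smallest modulus against which it is measured. The
  level \<open>k / 2\<close> and the size \<open>k^2 / 20\<close> are chosen so that the gain covers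
  both losses and the same level is recovered, which permits unlimited iteration.\<close>

lemma pinched_step:
  fixes P :: "'b \<Rightarrow> 'b \<Rightarrow> real" and e :: "'b \<Rightarrow> 'b \<Rightarrow> complex"
  assumes B: "finite B" "B \<noteq> {}"
    and P1: "\<And>x. x \<in> B \<Longrightarrow> (\<Sum>b\<in>B. P x b) = 1"
    and P0: "\<And>x b. x \<in> B \<Longrightarrow> b \<in> B \<Longrightarrow> 0 \<le> P x b"
    and Pk: "\<And>x y b. x \<in> B \<Longrightarrow> y \<in> B \<Longrightarrow> b \<in> B \<Longrightarrow> k * P y b \<le> P x b"
    and k: "0 < k" "k \<le> 1"
    and e: "\<And>x b. x \<in> B \<Longrightarrow> b \<in> B \<Longrightarrow> norm (e x b) \<le> k\<^sup>2 / 20"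
    and R: "pinched (k / 2) B R"
  shows "pinched (k / 2) B (\<lambda>x. \<Sum>b\<in>B. of_real (P x b) * (1 + e x b) * R b)"
proof -
  define \<delta> where "\<delta> = k\<^sup>2 / 20"
  define r where "r = Min ((\<lambda>b. norm (R b)) ` B)"
  define Q where "Q x = (\<Sum>b\<in>B. of_real (P x b) * R b)" for x
  let ?R = "\<lambda>x. \<Sum>b\<in>B. of_real (P x b) * (1 + e x b) * R b"
  have \<delta>: "0 \<le> \<delta>" by (simp add: \<delta>_def)
  have "r \<in> (\<lambda>b. norm (R b)) ` B" unfolding r_def using B by (intro Min_in) auto
  then obtain z where z: "z \<in> B" "r = norm (R z)" by auto
  then have r: "0 < r" using R by (auto simp: pinched_def)
  have r_le: "r \<le> norm (R b)" if "b \<in> B" for b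
    unfolding r_def using B that by (intro Min_le) auto
  have osc: "norm (R b - R b') \<le> k / 2 * r" if "b \<in> B" "b' \<in> B" for b b'
    using R z that by (auto simp: pinched_def)
  have upper: "norm (R b) \<le> 2 * r" if "b \<in> B" for b
  proof -
    have "norm (R b) \<le> norm (R z) + norm (R z - R b)"
      by (metis add.commute norm_minus_commute norm_triangle_sub)
    also have "\<dots> \<le> r + k / 2 * r" using osc[OF z(1) that] z by simp
    also have "\<dots> \<le> r + 1 * r" using k r by (intro add_left_mono mult_right_mono) auto
    finally show ?thesis by simp
  qed
  have pert: "norm (?R x - Q x) \<le> 2 * \<delta> * r" if x: "x \<in> B" for x
  proof -
    have "norm (?R x - Q x) = norm (\<Sum>b\<in>B. of_real (P x b) * e x b * R b)"
      by (simp add: Q_def sum_subtractf[symmetric] algebra_simps)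
    also have "\<dots> \<le> (\<Sum>b\<in>B. P x b * (\<delta> * (2 * r)))"
    proof (intro sum_norm_le)
      fix b assume b: "b \<in> B"
      have "norm (e x b) * norm (R b) \<le> \<delta> * (2 * r)"
        using e[OF x b] upper[OF b] \<delta> by (intro mult_mono) (auto simp: \<delta>_def)
      then show "norm (of_real (P x b) * e x b * R b) \<le> P x b * (\<delta> * (2 * r))"
        using P0[OF x b] by (simp add: norm_mult mult_left_mono mult.assoc)
    qed
    also have "\<dots> = 2 * \<delta> * r" using P1[OF x] by (simp flip: sum_distrib_right)
    finally show ?thesis .
  qed
  have lower: "(1 - k / 2 - 2 * \<delta>) * r \<le> norm (?R x)" if x: "x \<in> B" for x
  proof -
    have "norm (R z - Q x) = norm (\<Sum>b\<in>B. of_real (P x b) * (R z - R b))"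
      using P1[OF x] by (simp add: Q_def sum_subtractf algebra_simps flip: sum_distrib_left of_real_sum)
    also have "\<dots> \<le> (\<Sum>b\<in>B. P x b * (k / 2 * r))"
    proof (intro sum_norm_le)
      fix b assume b: "b \<in> B"
      show "norm (of_real (P x b) * (R z - R b)) \<le> P x b * (k / 2 * r)"
        using P0[OF x b] mult_left_mono[OF osc[OF z(1) b] P0[OF x b]]
        by (simp only: norm_mult norm_of_real abs_of_nonneg)
    qed
    also have "\<dots> = k / 2 * r" using P1[OF x] by (simp flip: sum_divide_distrib sum_distrib_right)
    finally have 1: "norm (R z - Q x) \<le> k / 2 * r" .
    have "norm (R z) \<le> norm (?R x) + norm (R z - Q x) + norm (?R x - Q x)"
      by (smt (verit) norm_triangle_ineq4 norm_triangle_sub norm_minus_commute)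
    then show ?thesis using 1 pert[OF x] z by (simp add: algebra_simps)
  qed
  have small: "k / 2 + 2 * \<delta> < 1"
    using k power_le_one[of k 2] by (simp add: \<delta>_def)
  \<comment> \<open>The budget, in units of \<delta> with \<open>k * k = 20 * \<delta>\<close>:
    contraction gains \<open>k * k / 2\<close>, that is 10; two perturbations cost 4; the drop of
    the smallest modulus costs \<open>k * k / 4\<close>, that is 5, plus \<open>k\<close>, at most
    1.\<close>
  have main: "(1 - k) * (k / 2) + 4 * \<delta> \<le> k / 2 * (1 - k / 2 - 2 * \<delta>)"
  proof -
    have "k * \<delta> \<le> 1 * \<delta>" using k \<delta> by (intro mult_right_mono) auto
    moreover have "k * k = 20 * \<delta>" by (simp add: \<delta>_def power2_eq_square)
    ultimately show ?thesis by (simp add: algebra_simps add_divide_distrib diff_divide_distrib)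
  qed
  show ?thesis unfolding pinched_def
  proof (intro ballI conjI)
    fix z assume z: "z \<in> B"
    have "0 < (1 - k / 2 - 2 * \<delta>) * r" using small r by simp
    then show "?R z \<noteq> 0" using lower[OF z] by fastforce
    fix x y assume x: "x \<in> B" and y: "y \<in> B"
    have "norm (Q x - Q y) \<le> (1 - k) * (k / 2 * r)"
      unfolding Q_def using P1 P0 Pk osc x y by (intro stochastic_kernel_contraction) auto
    moreover have "norm (?R x - ?R y) \<le> norm (Q x - Q y) + norm (?R x - Q x) + norm (?R y - Q y)"
      by (smt (verit) dist_norm dist_commute dist_triangle)
    ultimately have "norm (?R x - ?R y) \<le> (1 - k) * (k / 2 * r) + 4 * \<delta> * r"
      using pert[OF x] pert[OF y] by simp
    also have "\<dots> = ((1 - k) * (k / 2) + 4 * \<delta>) * r" by (simp add: algebra_simps)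
    also have "\<dots> \<le> (k / 2 * (1 - k / 2 - 2 * \<delta>)) * r" using main r by (intro mult_right_mono) auto
    also have "\<dots> = k / 2 * ((1 - k / 2 - 2 * \<delta>) * r)" by simp
    also have "\<dots> \<le> k / 2 * norm (?R z)" using lower[OF z] k by (intro mult_left_mono) auto
    finally show "norm (?R x - ?R y) \<le> k / 2 * norm (?R z)" .
  qed
qed

text \<open>The sum over all paths of \<open>j\<close> states followed by \<open>y\<close> of the
  product of the transition weights: a time-dependent matrix product applied to the constant 1. The
  value type is left general so that real and complex weights share the recursion.\<close>

fun transfer_iter :: "'b set \<Rightarrow> (nat \<Rightarrow> 'b \<Rightarrow> 'b \<Rightarrow> 'c::comm_semiring_1) \<Rightarrow> nat \<Rightarrow> 'b \<Rightarrow> 'c" where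
  "transfer_iter B w 0 = (\<lambda>y. 1)"
| "transfer_iter B w (Suc j) = (\<lambda>y. \<Sum>b\<in>B. w j b y * transfer_iter B w j b)"

lemma transfer_iter_pos:
  fixes w :: "nat \<Rightarrow> 'b \<Rightarrow> 'b \<Rightarrow> real"
  assumes "finite B" "B \<noteq> {}" "\<And>j b y. b \<in> B \<Longrightarrow> y \<in> B \<Longrightarrow> 0 < w j b y" "y \<in> B"
  shows "0 < transfer_iter B w j y"
  using assms(4) by (induction j arbitrary: y) (auto intro!: sum_pos mult_pos_pos assms(1-3))

text \<open>Dividing by the real iterate turns the recursion into an average followed by a small
  relative error, to which the one-step estimate applies. The constants depend on \<open>K\<close>
  alone, so nothing deteriorates as \<open>j\<close> grows.\<close>

lemma transfer_iter_perturbation: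
  fixes w :: "nat \<Rightarrow> 'b \<Rightarrow> 'b \<Rightarrow> real" and w' :: "nat \<Rightarrow> 'b \<Rightarrow> 'b \<Rightarrow> complex"
  assumes B: "finite B" "B \<noteq> {}" and K: "1 \<le> K"
    and w: "\<And>j b y. b \<in> B \<Longrightarrow> y \<in> B \<Longrightarrow> 1 / K \<le> w j b y \<and> w j b y \<le> K"
    and w': "\<And>j b y. b \<in> B \<Longrightarrow> y \<in> B \<Longrightarrow>
      norm (w' j b y - of_real (w j b y)) \<le> (1 / K ^ 4)\<^sup>2 / 20 * w j b y"
  shows "pinched (1 / K ^ 4 / 2) B (\<lambda>y. transfer_iter B w' j y / of_real (transfer_iter B w j y))"
proof (induction j)
  case 0
  show ?case using K by (simp add: pinched_def)
next
  case (Suc j)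
  define k where "k = 1 / K ^ 4"
  define u where "u = transfer_iter B w j"
  define v where "v = transfer_iter B w' j"
  define u' where "u' = transfer_iter B w (Suc j)"
  have u'_eq: "u' y = (\<Sum>b\<in>B. w j b y * u b)" for y by (simp add: u'_def u_def)
  have wpos: "0 < w i b y" if "b \<in> B" "y \<in> B" for i b y
    using w[OF that, of i] K by (smt (verit) divide_pos_pos)
  have u: "0 < u y" if "y \<in> B" for y unfolding u_def using B wpos that by (intro transfer_iter_pos)
  have u': "0 < u' y" if "y \<in> B" for y unfolding u'_def using B wpos that by (intro transfer_iter_pos)
  have w_ratio: "w j b x \<le> K\<^sup>2 * w j b y" if "b \<in> B" "x \<in> B" "y \<in> B" for b x y
  proof -
    have "w j b x \<le> K" using w that by auto
    also have "K = K\<^sup>2 * (1 / K)" using K by (simp add: power2_eq_square)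
    also have "\<dots> \<le> K\<^sup>2 * w j b y" using w that K by (intro mult_left_mono) auto
    finally show ?thesis .
  qed
  have u_ratio: "u' x \<le> K\<^sup>2 * u' y" if "x \<in> B" "y \<in> B" for x y
  proof -
    have "w j b x * u b \<le> K\<^sup>2 * w j b y * u b" if "b \<in> B" for b
      using w_ratio[OF that \<open>x \<in> B\<close> \<open>y \<in> B\<close>] u[OF that] by (intro mult_right_mono) auto
    then show ?thesis unfolding u'_eq sum_distrib_left by (auto intro!: sum_mono simp: mult.assoc)
  qed
  \<comment> \<open>The Doob transform of the weights by the real iterate \<open>u\<close>: each row
    sums to 1 because \<open>u'\<close> is the next iterate.\<close>
  define P where "P x b = w j b x * u b / u' x" for x b
  define e where "e x b = (w' j b x - of_real (w j b x)) / of_real (w j b x)" for x b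
  have P1: "(\<Sum>b\<in>B. P x b) = 1" if "x \<in> B" for x
    using u'[OF that] by (simp add: P_def u'_eq flip: sum_divide_distrib)
  have P0: "0 \<le> P x b" if "x \<in> B" "b \<in> B" for x b
    using u'[OF that(1)] u[OF that(2)] wpos[OF that(2,1), of j] by (simp add: P_def)
  \<comment> \<open>The factor \<open>u b\<close> is common to both rows. Exchanging the weights
    costs \<open>K^2\<close> and exchanging the normalisers costs another \<open>K^2\<close>, whence
    \<open>k = 1 / K ^ 4\<close>.\<close>
  have Pk: "k * P y b \<le> P x b" if x: "x \<in> B" and y: "y \<in> B" and b: "b \<in> B" for x y b
  proof -
    have "w j b y * u b * u' x \<le> (K\<^sup>2 * w j b x) * u b * (K\<^sup>2 * u' y)"
      using w_ratio[OF b y x] u_ratio[OF x y] u[OF b] u'[OF x] wpos[OF b x] K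
      by (intro mult_mono) (auto simp: less_imp_le)
    also have "\<dots> = K ^ 4 * (w j b x * u b * u' y)" by (simp add: power2_eq_square power4_eq_xxxx)
    finally show ?thesis using u'[OF x] u'[OF y] K by (simp add: P_def k_def field_simps)
  qed
  have e: "norm (e x b) \<le> k\<^sup>2 / 20" if "x \<in> B" "b \<in> B" for x b
    using w'[OF that(2,1), of j] wpos[OF that(2,1), of j]
    by (simp add: e_def k_def norm_divide divide_le_eq)
  have "pinched (k / 2) B (\<lambda>x. \<Sum>b\<in>B. of_real (P x b) * (1 + e x b) * (v b / of_real (u b)))"
    using B P1 P0 Pk e Suc.IH K by (intro pinched_step) (auto simp: k_def u_def v_def)
  moreover have "(\<Sum>b\<in>B. of_real (P x b) * (1 + e x b) * (v b / of_real (u b)))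
      = transfer_iter B w' (Suc j) x / of_real (u' x)" if x: "x \<in> B" for x
  proof -
    have "of_real (P x b) * (1 + e x b) * (v b / of_real (u b)) = w' j b x * v b / of_real (u' x)"
      if b: "b \<in> B" for b
      using u[OF b] u'[OF x] wpos[OF b x, of j] by (simp add: P_def e_def field_simps)
    then show ?thesis by (simp add: v_def sum_divide_distrib)
  qed
  ultimately show ?case by (simp add: pinched_def k_def u'_def)
qed

text \<open>The weights at the real centre \<open>l0\<close> serve as reference; they lie between
  \<open>1 / K\<close> and \<open>K\<close> for \<open>K = exp (|l0| * A)\<close>. The radius is
  fixed before the state set, the exponents and the number of steps, and this uniformity is the
  point.\<close>

lemma transfer_iter_exp_nonzero:
  fixes A l0 :: real
  assumes A: "0 \<le> A"
  obtains r where "r > 0"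
    "\<And>(B :: 'b set) a j l. \<lbrakk>finite B; B \<noteq> {}; \<And>i b y. b \<in> B \<Longrightarrow> y \<in> B \<Longrightarrow> \<bar>a i b y\<bar> \<le> A;
      l \<in> ball (of_real l0) r\<rbrakk>
      \<Longrightarrow> (\<Sum>y\<in>B. transfer_iter B (\<lambda>i b y. exp (l * of_real (a i b y))) j y) \<noteq> (0 :: complex)"
proof -
  define K where "K = exp (\<bar>l0\<bar> * A)"
  define d where "d = (1 / K ^ 4)\<^sup>2 / 20"
  have K: "1 \<le> K" using A by (simp add: K_def)
  have k: "0 < 1 / K ^ 4" "1 / K ^ 4 \<le> 1" using K by auto
  have d: "0 < d" "d \<le> 1" using k power_le_one[of "1 / K ^ 4" 2] K by (auto simp: d_def)
  \<comment> \<open>\<open>A + 1\<close> guards against \<open>A = 0\<close>, and the factor 2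
    leaves room for passing from \<open>|z|\<close> to \<open>|exp z - 1|\<close>.\<close>
  define r where "r = d / (2 * (A + 1))"
  have r: "r > 0" using d A by (simp add: r_def)
  have "(\<Sum>y\<in>B. transfer_iter B (\<lambda>i b y. exp (l * of_real (a i b y))) j y) \<noteq> 0"
    if B: "finite B" "B \<noteq> {}" and a: "\<And>i b y. b \<in> B \<Longrightarrow> y \<in> B \<Longrightarrow> \<bar>a i b y\<bar> \<le> A"
      and l: "l \<in> ball (of_real l0) r"
    for B :: "'b set" and a j and l :: complex
  proof -
    define w where "w i b y = exp (l0 * a i b y)" for i b y
    define w' where "w' i b y = exp (l * of_real (a i b y))" for i b y
    let ?u = "transfer_iter B w j" and ?v = "transfer_iter B w' j"
    have u: "0 < ?u y" if "y \<in> B" for y using B that by (intro transfer_iter_pos) (auto simp: w_def)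
    have "pinched (1 / K ^ 4 / 2) B (\<lambda>y. ?v y / of_real (?u y))"
    proof (intro transfer_iter_perturbation B K conjI)
      fix i b y assume bB: "b \<in> B" "y \<in> B"
      have "\<bar>l0 * a i b y\<bar> \<le> \<bar>l0\<bar> * A" using a[OF bB] by (simp add: abs_mult mult_left_mono)
      then show "w i b y \<le> K" "1 / K \<le> w i b y"
        by (auto simp: w_def K_def divide_le_eq simp flip: exp_add)
      let ?z = "(l - of_real l0) * of_real (a i b y)"
      have "norm ?z \<le> r * A"
        unfolding norm_mult using l a[OF bB] r
        by (intro mult_mono) (auto simp: dist_norm norm_minus_commute)
      also have "\<dots> \<le> d / 2" using A d by (simp add: r_def field_simps)
      finally have z: "norm ?z \<le> d / 2" .
      have "norm (exp ?z - 1) \<le> d"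
        using norm_exp_bounds(2)[of ?z] z d norm_ge_zero[of ?z] by linarith
      then have "norm (exp ?z - 1) * w i b y \<le> d * w i b y"
        by (intro mult_right_mono) (auto simp: w_def)
      moreover have "w' i b y - of_real (w i b y) = (exp ?z - 1) * of_real (w i b y)"
        by (simp add: w_def w'_def left_diff_distrib exp_of_real[symmetric] flip: exp_add)
      ultimately show "norm (w' i b y - of_real (w i b y)) \<le> (1 / K ^ 4)\<^sup>2 / 20 * w i b y"
        by (simp add: norm_mult d_def w_def)
    qed
    then have nz: "(\<Sum>y\<in>B. of_real (?u y) * (?v y / of_real (?u y))) \<noteq> 0"
      using B u k by (intro weighted_sum_pinched_nonzero) auto
    have "(\<Sum>y\<in>B. of_real (?u y) * (?v y / of_real (?u y))) = sum ?v B"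
      using u by (intro sum.cong) (auto simp: less_le)
    with nz show ?thesis by (simp add: w'_def[abs_def])
  qed
  with r show thesis by (rule that)
qed

section \<open>Normal families and almost additive sequences\<close>

text \<open>Zero-freeness serves to extract n-th roots. A subsequential limit \<open>g\<close> is
  enough, since the assumed real limit fixes \<open>|g|\<close> on the real axis; there \<phi> is
  the real part of a local logarithm of \<open>g\<close>.\<close>

lemma real_analytic_at_limit_log_norm:
  fixes Z :: "nat \<Rightarrow> complex \<Rightarrow> complex" and \<phi> :: "real \<Rightarrow> real"
  assumes r: "r > 0"
    and hol: "\<And>n. Z n holomorphic_on ball (of_real l0) r"
    and nz: "\<And>n z. z \<in> ball (of_real l0) r \<Longrightarrow> Z n z \<noteq> 0"
    and bound: "\<And>n z. z \<in> ball (of_real l0) r \<Longrightarrow> norm (Z n z) \<le> exp (K * real n)"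
    and lim: "\<And>x. \<bar>x - l0\<bar> < r \<Longrightarrow> (\<lambda>n. 1 / real n * ln (norm (Z n (of_real x)))) \<longlonglongrightarrow> \<phi> x"
  shows "\<exists>s>0. \<exists>c. \<forall>t. \<bar>t - l0\<bar> < s \<longrightarrow> (\<lambda>n. c n * (t - l0) ^ n) sums \<phi> t"
proof -
  let ?B = "ball (complex_of_real l0) r"
  have "\<exists>L. L holomorphic_on ?B \<and> (\<forall>z\<in>?B. exp (L z) = Z n z)" for n
  proof -
    obtain L where "L holomorphic_on ?B" "\<And>z. z \<in> ?B \<Longrightarrow> exp (L z) = Z n z"
      by (rule holomorphic_logarithm_exists[of ?B "Z n" "of_real l0"]) (use hol nz r in auto)
    then show ?thesis by blast
  qed
  then obtain L where L: "\<And>n. L n holomorphic_on ?B" "\<And>n z. z \<in> ?B \<Longrightarrow> exp (L n z) = Z n z"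
    by metis
  have Re_L: "Re (L n z) = ln (norm (Z n z))" if "z \<in> ?B" for n z
    using L(2)[OF that, of n] by (metis norm_exp_eq_Re ln_exp)
  \<comment> \<open>A branch of the n-th root of \<open>Z n\<close>: only its modulus matters, so that the branches need not
    be matched.\<close>
  define F where "F n z = exp (L n z * of_real (1 / real n))" for n z
  have normF: "norm (F n z) = exp (1 / real n * ln (norm (Z n z)))" if "z \<in> ?B" for n z
    using Re_L[OF that] by (simp add: F_def)
  have F_le: "norm (F n z) \<le> exp \<bar>K\<bar>" if "z \<in> ?B" for n z
  \<comment> \<open>For \<open>n = 0\<close> the exponent \<open>1 / real n\<close> is 0 by
    convention and \<open>F 0\<close> is 1; the bound with \<open>|K|\<close> in place of
    \<open>K\<close> covers this case too.\<close>
  proof (cases "n = 0")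
    case False
    have "ln (norm (Z n z)) \<le> K * real n"
      using bound[OF that, of n] nz[OF that, of n] by (metis exp_gt_zero ln_exp ln_le_cancel_iff zero_less_norm_iff)
    then have "1 / real n * ln (norm (Z n z)) \<le> 1 / real n * (K * real n)"
      by (intro mult_left_mono) auto
    then show ?thesis using False unfolding normF[OF that] by simp
  qed (simp add: F_def)
  obtain g \<rho> where g: "g holomorphic_on ?B" and \<rho>: "strict_mono (\<rho> :: nat \<Rightarrow> nat)"
    and gF: "\<And>x. x \<in> ?B \<Longrightarrow> (\<lambda>n. F (\<rho> n) x) \<longlonglongrightarrow> g x"
  proof (rule Montel[of ?B "range F" F])
    show "h holomorphic_on ?B" if "h \<in> range F" for h
      using that L(1) by (auto simp: F_def[abs_def] intro!: holomorphic_intros)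
    show "\<exists>B. \<forall>h\<in>range F. \<forall>z\<in>K'. norm (h z) \<le> B" if "K' \<subseteq> ?B" for K'
      using F_le that by blast
  qed auto
  have norm_g: "norm (g (of_real x)) = exp (\<phi> x)" if "\<bar>x - l0\<bar> < r" for x
  proof -
    have x: "of_real x \<in> ?B" using that by (simp add: dist_norm abs_minus_commute flip: of_real_diff)
    have "(\<lambda>n. norm (F (\<rho> n) (of_real x))) \<longlonglongrightarrow> norm (g (of_real x))"
      using gF[OF x] by (rule tendsto_norm)
    moreover have "(\<lambda>n. norm (F (\<rho> n) (of_real x))) \<longlonglongrightarrow> exp (\<phi> x)"
      unfolding normF[OF x] using LIMSEQ_subseq_LIMSEQ[OF lim[OF that] \<rho>]
      by (intro tendsto_exp) (simp add: o_def)
    ultimately show ?thesis by (rule LIMSEQ_unique)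
  qed
  \<comment> \<open>The modulus of \<open>g\<close> at the centre is an exponential, so
    \<open>g\<close> does not vanish there; continuity gives the smaller disc on which a logarithm
    exists.\<close>
  have g0: "g (of_real l0) \<noteq> 0" using norm_g[of l0] r by force
  obtain s where s: "s > 0" "s \<le> r" and gnz: "\<And>z. z \<in> ball (of_real l0) s \<Longrightarrow> g z \<noteq> 0"
  proof -
    have "isCont g (of_real l0)"
      using g r by (intro holomorphic_on_imp_continuous_on[THEN continuous_on_interior]) auto
    then obtain s where "s > 0" "\<forall>z. dist (of_real l0) z < s \<longrightarrow> g z \<noteq> 0"
      using continuous_at_avoid[of "of_real l0" g 0] g0 by auto
    then show thesis using r by (intro that[of "min s r"]) auto
  qed
  let ?C = "ball (complex_of_real l0) s"
  obtain \<Lambda> where \<Lambda>: "\<Lambda> holomorphic_on ?C" "\<And>z. z \<in> ?C \<Longrightarrow> exp (\<Lambda> z) = g z"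
    by (rule holomorphic_logarithm_exists[of ?C g "of_real l0"])
      (use gnz s holomorphic_on_subset[OF g subset_ball[OF s(2)]] in auto)
  \<comment> \<open>The centre and \<open>t\<close> are real, so real parts may be taken coefficient
    by coefficient.\<close>
  define c where "c n = Re ((deriv ^^ n) \<Lambda> (of_real l0) / fact n)" for n
  have Re_mult_of_real: "Re (u * complex_of_real v) = Re u * v" for u v by simp
  have "(\<lambda>n. c n * (t - l0) ^ n) sums \<phi> t" if t: "\<bar>t - l0\<bar> < s" for t
  proof -
    have tC: "of_real t \<in> ?C" using t by (simp add: dist_norm abs_minus_commute flip: of_real_diff)
    have "(\<lambda>n. (deriv ^^ n) \<Lambda> (of_real l0) / fact n * (of_real t - of_real l0) ^ n) sums \<Lambda> (of_real t)"
      using \<Lambda>(1) tC by (rule holomorphic_power_series)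
    then have "(\<lambda>n. Re ((deriv ^^ n) \<Lambda> (of_real l0) / fact n * (of_real t - of_real l0) ^ n))
        sums Re (\<Lambda> (of_real t))" by (rule sums_Re)
    also have "(\<lambda>n. Re ((deriv ^^ n) \<Lambda> (of_real l0) / fact n * (of_real t - of_real l0) ^ n))
        = (\<lambda>n. c n * (t - l0) ^ n)"
      by (simp only: c_def Re_mult_of_real flip: of_real_diff of_real_power)
    also have "Re (\<Lambda> (of_real t)) = \<phi> t"
      using norm_g[of t] \<Lambda>(2)[OF tC] t s by (metis norm_exp_eq_Re exp_inj_iff order_less_le_trans)
    finally show ?thesis .
  qed
  with s(1) show ?thesis by blast
qed

text \<open>Almost additivity reads \<open>a (j + k) - a j\<close> as \<open>a k\<close> at the j-th
  iterate, up to \<open>C\<close>. Summed over all starting points \<open>j < n\<close>, this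
  telescopes and compares \<open>k * a n\<close> with a Birkhoff sum of the fixed function
  \<open>a k\<close>, with error \<open>n * C\<close> plus a term depending on \<open>k\<close>
  only. Dividing by \<open>n * k\<close> leaves an error of order \<open>C / k\<close>, and the
  comparison value \<open>I k / k\<close> does not involve \<omega>.\<close>

lemma almost_additive_limit:
  fixes a :: "nat \<Rightarrow> 'a \<Rightarrow> real" and T :: "'a \<Rightarrow> 'a"
  assumes T: "T \<in> \<Omega> \<rightarrow> \<Omega>"
    and add: "\<And>n k \<omega>. \<omega> \<in> \<Omega> \<Longrightarrow> \<bar>a (n + k) \<omega> - a n \<omega> - a k ((T ^^ n) \<omega>)\<bar> \<le> C"
    and bdd: "\<And>k. \<exists>D. \<forall>\<omega>\<in>\<Omega>. \<bar>a k \<omega>\<bar> \<le> D"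
    and birkhoff: "\<And>k. \<exists>I. \<forall>\<omega>\<in>\<Omega>. (\<lambda>n. (\<Sum>j<n. a k ((T ^^ j) \<omega>)) / real n) \<longlonglongrightarrow> I"
  shows "\<exists>L. \<forall>\<omega>\<in>\<Omega>. (\<lambda>n. a n \<omega> / real n) \<longlonglongrightarrow> L"
proof (cases "\<Omega> = {}")
  case False
  then obtain \<omega>0 where "\<omega>0 \<in> \<Omega>" by auto
  then have C: "0 \<le> C" using add[of \<omega>0 0 0] by linarith
  obtain I where I: "\<And>k \<omega>. \<omega> \<in> \<Omega> \<Longrightarrow> (\<lambda>n. (\<Sum>j<n. a k ((T ^^ j) \<omega>)) / real n) \<longlonglongrightarrow> I k"
    using birkhoff by metis
  obtain D where D: "\<And>k \<omega>. \<omega> \<in> \<Omega> \<Longrightarrow> \<bar>a k \<omega>\<bar> \<le> D k" using bdd by metis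
  have iter: "(T ^^ n) \<omega> \<in> \<Omega>" if "\<omega> \<in> \<Omega>" for n \<omega> using that T by (induction n) auto
  have block: "\<bar>real k * a n \<omega> - (\<Sum>j<n. a k ((T ^^ j) \<omega>))\<bar> \<le> real n * C + (real k * C + 2 * sum D {..<k})"
    if \<omega>: "\<omega> \<in> \<Omega>" for n k \<omega>
  proof -
    \<comment> \<open>Only \<open>k\<close> terms survive at each end; those near \<open>n\<close>
      are then replaced by \<open>a n\<close> at bounded cost, which produces
      \<open>k * a n\<close>.\<close>
    have tele: "(\<Sum>j<n. a (j + k) \<omega>) - (\<Sum>j<n. a j \<omega>) = (\<Sum>i<k. a (n + i) \<omega>) - (\<Sum>i<k. a i \<omega>)"
    proof (induction n)
      case (Suc n)
      have "(\<Sum>i<k. a (Suc n + i) \<omega>) + a n \<omega> = (\<Sum>i<k. a (n + i) \<omega>) + a (n + k) \<omega>"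
        by (induction k) auto
      then show ?case using Suc.IH by simp
    qed simp
    have "\<bar>\<Sum>j<n. a (j + k) \<omega> - a j \<omega> - a k ((T ^^ j) \<omega>)\<bar> \<le> (\<Sum>j<n. C)"
      using add[OF \<omega>] by (intro order_trans[OF sum_abs] sum_mono) auto
    then have 1: "\<bar>(\<Sum>i<k. a (n + i) \<omega>) - (\<Sum>i<k. a i \<omega>) - (\<Sum>j<n. a k ((T ^^ j) \<omega>))\<bar> \<le> real n * C"
      using tele by (simp add: sum_subtractf)
    have "\<bar>\<Sum>i<k. a (n + i) \<omega> - a n \<omega> - a i ((T ^^ n) \<omega>)\<bar> \<le> (\<Sum>j<k. C)"
      using add[OF \<omega>] by (intro order_trans[OF sum_abs] sum_mono) auto
    then have 2: "\<bar>(\<Sum>i<k. a (n + i) \<omega>) - real k * a n \<omega> - (\<Sum>i<k. a i ((T ^^ n) \<omega>))\<bar> \<le> real k * C"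
      by (simp add: sum_subtractf)
    have 3: "\<bar>\<Sum>i<k. a i ((T ^^ n) \<omega>)\<bar> \<le> sum D {..<k}" "\<bar>\<Sum>i<k. a i \<omega>\<bar> \<le> sum D {..<k}"
      using D[OF iter[OF \<omega>]] D[OF \<omega>] by (auto intro!: order_trans[OF sum_abs] sum_mono)
    show ?thesis using 1 2 3 by (simp add: abs_le_iff)
  qed
  \<comment> \<open>The extra 1 beside \<open>C\<close> absorbs the Birkhoff error and the end terms
    \<open>E / n\<close> once \<open>n\<close> is large.\<close>
  have close: "\<forall>\<^sub>F n in sequentially. \<bar>a n \<omega> / real n - I k / real k\<bar> \<le> (C + 1) / real k"
    if \<omega>: "\<omega> \<in> \<Omega>" and k: "k > 0" for \<omega> k
  proof -
    define E where "E = real k * C + 2 * sum D {..<k}"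
    let ?S = "\<lambda>n. (\<Sum>j<n. a k ((T ^^ j) \<omega>)) / real n"
    have "(\<lambda>n. \<bar>?S n - I k\<bar> + E / real n) \<longlonglongrightarrow> \<bar>I k - I k\<bar> + 0"
      by (intro tendsto_intros I[OF \<omega>] tendsto_divide_0[OF tendsto_const] filterlim_at_top_imp_at_infinity
          filterlim_real_sequentially)
    then have "\<forall>\<^sub>F n in sequentially. \<bar>?S n - I k\<bar> + E / real n < 1"
      by (intro order_tendstoD) auto
    then show ?thesis using eventually_gt_at_top[of 0]
    proof eventually_elim
      case (elim n)
      have "\<bar>real k * a n \<omega> - real n * ?S n\<bar> \<le> real n * C + E"
        using block[OF \<omega>, of k n] elim(2) by (simp add: E_def)
      then have "\<bar>real k * a n \<omega> - real n * ?S n\<bar> / real n \<le> (real n * C + E) / real n"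
        by (rule divide_right_mono) simp
      also have "\<dots> = C + E / real n" using elim(2) by (simp add: field_simps)
      also have "\<bar>real k * a n \<omega> - real n * ?S n\<bar> / real n = \<bar>(real k * a n \<omega> - real n * ?S n) / real n\<bar>"
        by simp
      also have "(real k * a n \<omega> - real n * ?S n) / real n = real k * (a n \<omega> / real n) - ?S n"
        using elim(2) by (simp add: diff_divide_distrib)
      finally have "\<bar>real k * (a n \<omega> / real n) - I k\<bar> \<le> C + 1" using elim(1) by linarith
      then have "\<bar>real k * (a n \<omega> / real n) - I k\<bar> / real k \<le> (C + 1) / real k"
        by (rule divide_right_mono) simp
      also have "\<bar>real k * (a n \<omega> / real n) - I k\<bar> / real k = \<bar>(real k * (a n \<omega> / real n) - I k) / real k\<bar>"
        by simp
      also have "(real k * (a n \<omega> / real n) - I k) / real k = a n \<omega> / real n - I k / real k"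
        using k by (simp add: diff_divide_distrib)
      finally show ?case .
    qed
  qed
  have to0: "(\<lambda>k. (C + 1) / real k) \<longlonglongrightarrow> 0"
    by (intro tendsto_divide_0[OF tendsto_const] filterlim_at_top_imp_at_infinity filterlim_real_sequentially)
  have "convergent (\<lambda>n. a n \<omega> / real n)" if \<omega>: "\<omega> \<in> \<Omega>" for \<omega>
    unfolding Cauchy_convergent_iff[symmetric] Cauchy_def
  proof (intro allI impI)
    fix e :: real assume e: "e > 0"
    have "\<forall>\<^sub>F k in sequentially. (C + 1) / real k < e / 2 \<and> k > 0"
      using order_tendstoD(2)[OF to0, of "e / 2"] e by (intro eventually_conj eventually_gt_at_top) auto
    then obtain k where k: "(C + 1) / real k < e / 2" "k > 0"
      using eventually_happens'[OF sequentially_bot] by blast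
    obtain N where N: "\<And>n. n \<ge> N \<Longrightarrow> \<bar>a n \<omega> / real n - I k / real k\<bar> \<le> (C + 1) / real k"
      using close[OF \<omega> k(2)] by (auto simp: eventually_sequentially)
    have "dist (a m \<omega> / real m) (a n \<omega> / real n) < e" if "m \<ge> N" "n \<ge> N" for m n
      using N[OF that(1)] N[OF that(2)] k(1) unfolding dist_real_def by linarith
    then show "\<exists>M. \<forall>m\<ge>M. \<forall>n\<ge>M. dist (a m \<omega> / real m) (a n \<omega> / real n) < e" by blast
  qed
  then obtain L where L: "\<And>\<omega>. \<omega> \<in> \<Omega> \<Longrightarrow> (\<lambda>n. a n \<omega> / real n) \<longlonglongrightarrow> L \<omega>"
    unfolding convergent_def by metis
  \<comment> \<open>The limit at each \<omega> is identified with that of a sequence free of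
    \<omega>, so all these limits agree.\<close>
  have LI: "(\<lambda>k. I k / real k) \<longlonglongrightarrow> L \<omega>" if \<omega>: "\<omega> \<in> \<Omega>" for \<omega>
  proof -
    have LIk: "\<bar>L \<omega> - I k / real k\<bar> \<le> (C + 1) / real k" if "k > 0" for k
      using close[OF \<omega> that]
      by (intro tendsto_upperbound[where F = sequentially and f = "\<lambda>n. \<bar>a n \<omega> / real n - I k / real k\<bar>"])
        (auto intro!: tendsto_intros L \<omega>)
    have "\<forall>\<^sub>F k in sequentially. norm (I k / real k - L \<omega>) \<le> (C + 1) / real k"
      by (rule eventually_mono[OF eventually_gt_at_top[of 0]]) (use LIk in \<open>auto simp: abs_minus_commute\<close>)
    from Lim_null_comparison[OF this to0] show ?thesis by (rule Lim_null[THEN iffD2])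
  qed
  then have "L \<omega> = L \<omega>0" if "\<omega> \<in> \<Omega>" for \<omega>
    using that \<open>\<omega>0 \<in> \<Omega>\<close> LIMSEQ_unique by blast
  then show ?thesis using L by metis
qed auto

section \<open>Birkhoff averages of uniquely ergodic systems\<close>

text \<open>The digits of \<open>e x\<close> record which balls of a countable family contain
  \<open>x\<close>, the family holding a finite cover of \<Omega> at every scale. The function
  \<open>e\<close> need not be continuous; the conclusion is uniform continuity of its inverse. The
  upper bound 2 rounds up the geometric sum 3/2.\<close>

lemma exists_separating_code:
  fixes \<Omega> :: "'a::metric_space set"
  assumes \<Omega>: "compact \<Omega>" "\<Omega> \<noteq> {}"
  obtains e :: "'a \<Rightarrow> real" where "\<And>x. 0 \<le> e x \<and> e x \<le> 2"
    "\<And>\<epsilon>. \<epsilon> > 0 \<Longrightarrow> \<exists>\<delta>>0. \<forall>x\<in>\<Omega>. \<forall>y\<in>\<Omega>. \<bar>e x - e y\<bar> < \<delta> \<longrightarrow> dist x y < \<epsilon>"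
proof -
  have "\<exists>U. finite U \<and> \<Omega> \<subseteq> (\<Union>c\<in>U. ball c (1 / real (Suc n)))" for n
    using \<Omega>(1) by (auto simp: compact_eq_totally_bounded)
  then obtain U where U: "\<And>n. finite (U n)" "\<And>n. \<Omega> \<subseteq> (\<Union>c\<in>U n. ball c (1 / real (Suc n)))" by metis
  define \<A> where "\<A> = (\<Union>n. (\<lambda>c. ball c (1 / real (Suc n))) ` U n)"
  have "countable \<A>" unfolding \<A>_def using U(1) by (intro countable_UN countable_image) (auto intro: countable_finite)
  moreover have "\<A> \<noteq> {}" using U(2)[of 0] \<Omega>(2) unfolding \<A>_def by fastforce
  moreover define A where "A = from_nat_into \<A>"
  ultimately have A: "range A = \<A>" by (simp add: range_from_nat_into)
  define d where "d i x = (indicator (A i) x :: real)" for i x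
  define e where "e x = (\<Sum>i. d i x * (1 / 3) ^ i)" for x
  have geo: "(\<lambda>i. (1 / 3) ^ i :: real) sums (3 / 2)" using geometric_sums[of "1 / 3 :: real"] by simp
  have summ: "summable (\<lambda>i. d i x * (1 / 3) ^ i)" for x
    by (rule summable_comparison_test'[OF sums_summable[OF geo], of 0]) (auto simp: d_def indicator_def)
  have e_bounds: "0 \<le> e x \<and> e x \<le> 2" for x
  proof
    show "0 \<le> e x" unfolding e_def by (intro suminf_nonneg summ) (auto simp: d_def)
    have "e x \<le> (\<Sum>i. (1 / 3) ^ i)" unfolding e_def
      by (intro suminf_le summ sums_summable[OF geo]) (auto simp: d_def indicator_def)
    then show "e x \<le> 2" using sums_unique[OF geo] by simp
  qed
  \<comment> \<open>Base 3 is what makes the first differing digit decisive: all later digits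
    together contribute at most half its weight.\<close>
  have sep: "\<bar>e x - e y\<bar> \<ge> (1 / 3) ^ i / 2"
    if i: "d i x \<noteq> d i y" and less: "\<And>j. j < i \<Longrightarrow> d j x = d j y" for x y i
  proof -
    let ?f = "\<lambda>j. (d j x - d j y) * (1 / 3) ^ j"
    have sf: "summable ?f" using summable_diff[OF summ[of x] summ[of y]] by (simp add: left_diff_distrib)
    have "e x - e y = suminf ?f"
      unfolding e_def using suminf_diff[OF summ[of x] summ[of y]] by (simp add: left_diff_distrib)
    also have "\<dots> = (\<Sum>j. ?f (j + Suc i)) + sum ?f {..<Suc i}"
      by (rule suminf_split_initial_segment[OF sf])
    also have "sum ?f {..<Suc i} = ?f i" using less by simp
    finally have eq: "e x - e y = (\<Sum>j. ?f (j + Suc i)) + ?f i" .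
    have gs: "(\<lambda>j. (1 / 3) ^ j * (1 / 3) ^ Suc i :: real) sums (3 / 2 * (1 / 3) ^ Suc i)"
      by (rule sums_mult2[OF geo])
    have "norm (\<Sum>j. ?f (j + Suc i)) \<le> (\<Sum>j. (1 / 3) ^ j * (1 / 3) ^ Suc i)"
    proof (rule norm_suminf_le[OF _ sums_summable[OF gs]])
      fix j
      have "\<bar>d (j + Suc i) x - d (j + Suc i) y\<bar> \<le> 1" by (auto simp: d_def indicator_def)
      from mult_right_mono[OF this, of "(1 / 3) ^ (j + Suc i)"] show "norm (?f (j + Suc i)) \<le> (1 / 3) ^ j * (1 / 3) ^ Suc i"
        by (simp add: abs_mult power_add)
    qed
    also have "\<dots> = (1 / 3) ^ i / 2" using sums_unique[OF gs] by simp
    finally have "\<bar>\<Sum>j. ?f (j + Suc i)\<bar> \<le> (1 / 3) ^ i / 2" by simp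
    moreover have "\<bar>?f i\<bar> = (1 / 3) ^ i"
      using i by (auto simp: d_def indicator_def split: if_splits)
    ultimately show ?thesis unfolding eq by linarith
  qed
  have "\<exists>\<delta>>0. \<forall>x\<in>\<Omega>. \<forall>y\<in>\<Omega>. \<bar>e x - e y\<bar> < \<delta> \<longrightarrow> dist x y < \<epsilon>" if \<epsilon>: "\<epsilon> > 0" for \<epsilon>
  proof -
    obtain n where n: "1 / real (Suc n) < \<epsilon> / 2" using nat_approx_posE[of "\<epsilon> / 2"] \<epsilon> by auto
    have "\<exists>i. A i = ball c (1 / real (Suc n))" if "c \<in> U n" for c
    proof -
      have "ball c (1 / real (Suc n)) \<in> range A" using that unfolding A \<A>_def by blast
      then show ?thesis by auto
    qed
    then obtain ix where ix: "\<And>c. c \<in> U n \<Longrightarrow> A (ix c) = ball c (1 / real (Suc n))" by metis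
    \<comment> \<open>The balls of one scale are finite in number, so agreement of the digits up to
      \<open>N\<close> decides membership in all of them; two points of a common ball are less than
      \<epsilon> apart.\<close>
    define N where "N = Max (insert 0 (ix ` U n))"
    have N: "ix c \<le> N" if "c \<in> U n" for c unfolding N_def using U(1) that by (intro Max_ge) auto
    have "dist x y < \<epsilon>" if x: "x \<in> \<Omega>" and y: "y \<in> \<Omega>" and less: "\<bar>e x - e y\<bar> < (1 / 3) ^ N / 2" for x y
    proof -
      have agree: "d i x = d i y" if "i \<le> N" for i
      proof (rule ccontr)
        assume "d i x \<noteq> d i y"
        define i0 where "i0 = (LEAST i. d i x \<noteq> d i y)"
        have i0: "d i0 x \<noteq> d i0 y" unfolding i0_def using \<open>d i x \<noteq> d i y\<close> by (rule LeastI)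
        have "i0 \<le> i" unfolding i0_def using \<open>d i x \<noteq> d i y\<close> by (rule Least_le)
        moreover have "(1 / 3) ^ i0 / 2 \<le> \<bar>e x - e y\<bar>"
          using i0 by (rule sep) (use not_less_Least in \<open>auto simp: i0_def\<close>)
        moreover have "(1 / 3 :: real) ^ N \<le> (1 / 3) ^ i0"
          using \<open>i0 \<le> i\<close> that by (intro power_decreasing) auto
        ultimately show False using less by simp
      qed
      obtain c where c: "c \<in> U n" "x \<in> ball c (1 / real (Suc n))" using U(2)[of n] x by auto
      then have "y \<in> ball c (1 / real (Suc n))"
        using agree[OF N[OF c(1)]] ix[OF c(1)] by (auto simp: d_def indicator_def split: if_splits)
      then show ?thesis
        using c(2) n dist_triangle[of x y c] unfolding mem_ball dist_commute[of x c] by linarith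
    qed
    then show ?thesis by (intro exI[of _ "(1 / 3) ^ N / 2"]) auto
  qed
  with e_bounds show thesis by (rule that)
qed

text \<open>The inverse of the code is uniformly continuous on the set of codes, hence extends to
  its closure, and compactness of \<Omega> keeps the extended values in \<Omega>. Thus \<Omega> is a
  continuous image of a compact set of reals, with \<open>e\<close> as a section.\<close>

lemma exists_compact_coding:
  fixes \<Omega> :: "'a::metric_space set"
  assumes \<Omega>: "compact \<Omega>" "\<Omega> \<noteq> {}"
  obtains e :: "'a \<Rightarrow> real" and K \<pi> where "\<And>x. 0 \<le> e x \<and> e x \<le> 2" "closed K" "e ` \<Omega> \<subseteq> K"
    "\<pi> \<in> K \<rightarrow> \<Omega>" "continuous_on K \<pi>" "\<And>x. x \<in> \<Omega> \<Longrightarrow> \<pi> (e x) = x"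
proof -
  obtain e :: "'a \<Rightarrow> real" where e: "\<And>x. 0 \<le> e x \<and> e x \<le> 2"
    and sep: "\<And>\<epsilon>. \<epsilon> > 0 \<Longrightarrow> \<exists>\<delta>>0. \<forall>x\<in>\<Omega>. \<forall>y\<in>\<Omega>. \<bar>e x - e y\<bar> < \<delta> \<longrightarrow> dist x y < \<epsilon>"
    using exists_separating_code[OF \<Omega>] by metis
  let ?K = "closure (e ` \<Omega>)"
  have "\<exists>w\<in>\<Omega>. \<exists>z. (\<forall>n. z n \<in> \<Omega>) \<and> z \<longlonglongrightarrow> w \<and> (\<lambda>n. e (z n)) \<longlonglongrightarrow> x" if x: "x \<in> ?K" for x
  proof -
    obtain t where t: "\<And>n. t n \<in> e ` \<Omega>" "t \<longlonglongrightarrow> x" using x closure_sequential by blast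
    have "\<exists>z. z \<in> \<Omega> \<and> t n = e z" for n using t(1)[of n] by auto
    then obtain z where z: "\<And>n. z n \<in> \<Omega>" "\<And>n. t n = e (z n)" by metis
    obtain w r where w: "w \<in> \<Omega>" "strict_mono r" "(z \<circ> r) \<longlonglongrightarrow> w"
      using \<Omega>(1)[unfolded compact_def, THEN spec, of z] z(1) by auto
    have "(\<lambda>n. e ((z \<circ> r) n)) \<longlonglongrightarrow> x"
      using LIMSEQ_subseq_LIMSEQ[OF t(2) w(2)] z(2) by (simp add: o_def)
    then show ?thesis using w z(1) by (intro bexI[of _ w] exI[of _ "z \<circ> r"]) auto
  qed
  then obtain \<pi> z where \<pi>: "\<And>x. x \<in> ?K \<Longrightarrow> \<pi> x \<in> \<Omega>"
    and z: "\<And>x n. x \<in> ?K \<Longrightarrow> z x n \<in> \<Omega>" "\<And>x. x \<in> ?K \<Longrightarrow> z x \<longlonglongrightarrow> \<pi> x"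
      "\<And>x. x \<in> ?K \<Longrightarrow> (\<lambda>n. e (z x n)) \<longlonglongrightarrow> x"
    by metis
  \<comment> \<open>The modulus of continuity passes to limits of any two approximating sequences.
    Used for nearby points it gives continuity of \<pi>; used for one code with two sequences it
    gives \<open>\<pi> (e w) = w\<close>, whatever sequence was chosen.\<close>
  have lim_close: "dist w w' \<le> \<epsilon>"
    if "\<And>n. u n \<in> \<Omega>" "\<And>n. u' n \<in> \<Omega>" "u \<longlonglongrightarrow> w" "u' \<longlonglongrightarrow> w'"
      "(\<lambda>n. e (u n)) \<longlonglongrightarrow> x" "(\<lambda>n. e (u' n)) \<longlonglongrightarrow> x'" "\<bar>x - x'\<bar> < \<delta>"
      "\<forall>x\<in>\<Omega>. \<forall>y\<in>\<Omega>. \<bar>e x - e y\<bar> < \<delta> \<longrightarrow> dist x y < \<epsilon>" for u u' w w' x x' \<delta> \<epsilon>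
  proof -
    have "(\<lambda>n. \<bar>e (u n) - e (u' n)\<bar>) \<longlonglongrightarrow> \<bar>x - x'\<bar>" by (intro tendsto_intros that)
    then have "\<forall>\<^sub>F n in sequentially. \<bar>e (u n) - e (u' n)\<bar> < \<delta>" using that(7) by (rule order_tendstoD)
    then have "\<forall>\<^sub>F n in sequentially. dist (u n) (u' n) \<le> \<epsilon>"
      by eventually_elim (use that(1,2,8) in \<open>auto intro: less_imp_le\<close>)
    moreover have "(\<lambda>n. dist (u n) (u' n)) \<longlonglongrightarrow> dist w w'" by (intro tendsto_intros that)
    ultimately show ?thesis using tendsto_upperbound sequentially_bot by blast
  qed
  have cont: "continuous_on ?K \<pi>" unfolding continuous_on_iff
  proof (intro ballI allI impI)
    fix x and \<epsilon> :: real assume x: "x \<in> ?K" and \<epsilon>: "\<epsilon> > 0"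
    obtain \<delta> where \<delta>: "\<delta> > 0" "\<forall>x\<in>\<Omega>. \<forall>y\<in>\<Omega>. \<bar>e x - e y\<bar> < \<delta> \<longrightarrow> dist x y < \<epsilon> / 2"
      using sep[of "\<epsilon> / 2"] \<epsilon> by auto
    have "dist (\<pi> x') (\<pi> x) < \<epsilon>" if x': "x' \<in> ?K" "dist x' x < \<delta>" for x'
      using lim_close[OF z(1)[OF x'(1)] z(1)[OF x] z(2)[OF x'(1)] z(2)[OF x] z(3)[OF x'(1)] z(3)[OF x] _ \<delta>(2)]
        x'(2) \<epsilon> by (simp add: dist_real_def)
    then show "\<exists>d>0. \<forall>x'\<in>?K. dist x' x < d \<longrightarrow> dist (\<pi> x') (\<pi> x) < \<epsilon>" using \<delta>(1) by blast
  qed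
  have inv: "\<pi> (e w) = w" if w: "w \<in> \<Omega>" for w
  proof -
    have K: "e w \<in> ?K" using w closure_subset[of "e ` \<Omega>"] by auto
    have "dist (\<pi> (e w)) w \<le> \<epsilon>" if \<epsilon>: "\<epsilon> > 0" for \<epsilon>
    proof -
      obtain \<delta> where \<delta>: "\<delta> > 0" "\<forall>x\<in>\<Omega>. \<forall>y\<in>\<Omega>. \<bar>e x - e y\<bar> < \<delta> \<longrightarrow> dist x y < \<epsilon>"
        using sep[OF \<epsilon>] by auto
      show ?thesis
        by (rule lim_close[OF z(1)[OF K] w z(2)[OF K] tendsto_const z(3)[OF K] tendsto_const _ \<delta>(2)])
          (use \<delta>(1) in simp)
    qed
    then have "dist (\<pi> (e w)) w \<le> 0" by (rule dense_ge)
    then show ?thesis by simp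
  qed
  show thesis
  proof (rule that[of e ?K \<pi>])
    show "\<pi> \<in> ?K \<rightarrow> \<Omega>" using \<pi> by auto
    show "e ` \<Omega> \<subseteq> ?K" by (rule closure_subset)
  qed (use e cont inv in auto)
qed

section \<open>Measures determined by continuous functions, and limits of empirical measures\<close>

text \<open>Indicators of closed sets are limits of truncated multiples of the distance, and closed
  sets form an intersection-stable generator of the Borel sets.\<close>

lemma closed_space_measure_eqI:
  fixes \<Omega> :: "'a::metric_space set"
  assumes M: "finite_measure M" "sets M = sets (restrict_space borel \<Omega>)"
    and N: "finite_measure N" "sets N = sets (restrict_space borel \<Omega>)"
    and eq: "\<And>g :: 'a \<Rightarrow> real. continuous_on \<Omega> g \<Longrightarrow> integral\<^sup>L M g = integral\<^sup>L N g"
  shows "M = N"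
proof -
  have space: "space L = \<Omega>" if "sets L = sets (restrict_space borel \<Omega>)" for L :: "'a measure"
    using sets_eq_imp_space_eq[OF that] by (simp add: space_restrict_space)
  have Int: "F \<inter> \<Omega> \<in> sets L" if "sets L = sets (restrict_space borel \<Omega>)" "F \<in> sets borel" for L :: "'a measure" and F
    using that by (auto simp: sets_restrict_space)
  have id: "(\<lambda>x. x) \<in> measurable L borel" if L: "sets L = sets (restrict_space borel \<Omega>)" for L :: "'a measure"
    using measurable_cong_sets[OF L refl] measurable_restrict_space1[of "\<lambda>x. x" borel borel] by auto
  have lim: "(\<lambda>n. \<integral>x. max 0 (1 - real n * infdist x F) \<partial>L) \<longlonglongrightarrow> measure L (F \<inter> \<Omega>)"
    if L: "finite_measure L" "sets L = sets (restrict_space borel \<Omega>)" and F: "closed F" "F \<noteq> {}"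
    for L and F :: "'a set"
  proof -
    interpret finite_measure L by fact
    have "(\<lambda>n. \<integral>x. max 0 (1 - real n * infdist x F) \<partial>L) \<longlonglongrightarrow> (\<integral>x. indicator F x \<partial>L)"
    proof (rule integral_dominated_convergence[where w = "\<lambda>_. 1"])
      have "(\<lambda>x. max 0 (1 - real n * infdist x F)) \<in> borel_measurable borel" for n
        by (intro borel_measurable_continuous_onI continuous_intros)
      then show "(\<lambda>x. max 0 (1 - real n * infdist x F)) \<in> borel_measurable L" for n
        by (rule measurable_compose[OF id[OF L(2)]])
      show "(indicator F :: 'a \<Rightarrow> real) \<in> borel_measurable L"
        using measurable_compose[OF id[OF L(2)] borel_measurable_indicator[OF borel_closed[OF F(1)]]] .
      show "AE x in L. (\<lambda>n. max 0 (1 - real n * infdist x F)) \<longlonglongrightarrow> indicator F x"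
      proof (intro AE_I2)
        fix x
        show "(\<lambda>n. max 0 (1 - real n * infdist x F)) \<longlonglongrightarrow> indicator F x"
        proof (cases "x \<in> F")
          case False
          then have pos: "infdist x F > 0" using F in_closed_iff_infdist_zero infdist_nonneg by (metis less_le)
          obtain N where N: "real N * infdist x F > 1" using reals_Archimedean3[OF pos] by blast
          have "\<forall>\<^sub>F n in sequentially. max 0 (1 - real n * infdist x F) = 0"
          proof (rule eventually_sequentiallyI)
            fix n assume "N \<le> n"
            then have "real N * infdist x F \<le> real n * infdist x F" using pos by (intro mult_right_mono) auto
            then show "max 0 (1 - real n * infdist x F) = 0" using N by simp
          qed
          then show ?thesis using False by (simp add: tendsto_eventually)
        qed simp
      qed
      show "AE x in L. norm (max 0 (1 - real n * infdist x F)) \<le> 1" for n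
        by (auto simp: infdist_nonneg)
    qed (simp add: integrable_const)
    also have "(\<integral>x. indicator F x \<partial>L) = measure L (F \<inter> \<Omega>)" using space[OF L(2)] by simp
    finally show ?thesis .
  qed
  have closed_eq: "measure M (F \<inter> \<Omega>) = measure N (F \<inter> \<Omega>)" if "closed F" for F
  \<comment> \<open>The distance to the empty set is 0 by convention, so the approximating functions
    would converge to 1 instead of the indicator.\<close>
  proof (cases "F = {}")
    case False
    have "(\<integral>x. max 0 (1 - real n * infdist x F) \<partial>M) = (\<integral>x. max 0 (1 - real n * infdist x F) \<partial>N)" for n
      by (intro eq continuous_intros)
    then show ?thesis using lim[OF M that False] lim[OF N that False] LIMSEQ_unique by simp
  qed simp
  interpret M: finite_measure M by fact
  interpret N: finite_measure N by fact
  \<comment> \<open>Both measures are viewed on the whole type, where the generator is the family of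
    all closed sets.\<close>
  have "distr M borel (\<lambda>x. x) = distr N borel (\<lambda>x. x)"
  proof (rule measure_eqI_generator_eq[where E = "Collect closed" and \<Omega> = UNIV and A = "\<lambda>_. UNIV"])
    show "Int_stable (Collect closed :: 'a set set)" by (auto simp: Int_stable_def)
    fix F :: "'a set" assume "F \<in> Collect closed"
    then show "emeasure (distr M borel (\<lambda>x. x)) F = emeasure (distr N borel (\<lambda>x. x)) F"
      using closed_eq[of F] id[OF M(2)] id[OF N(2)] space[OF M(2)] space[OF N(2)]
      by (simp add: emeasure_distr M.emeasure_eq_measure N.emeasure_eq_measure Int_commute)
  qed (auto simp: borel_eq_closed emeasure_distr id[OF M(2), unfolded borel_eq_closed] M.emeasure_eq_measure)
  then have eq': "emeasure M (F \<inter> \<Omega>) = emeasure N (F \<inter> \<Omega>)" if "F \<in> sets borel" for F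
    using that id[OF M(2)] id[OF N(2)] space[OF M(2)] space[OF N(2)]
    by (metis emeasure_distr vimage_ident)
  show ?thesis
  proof (rule measure_eqI)
    fix X assume "X \<in> sets M"
    then obtain F where "F \<in> sets borel" "X = F \<inter> \<Omega>" unfolding M(2) by (auto simp: sets_restrict_space)
    then show "emeasure M X = emeasure N X" using eq' by simp
  qed (simp add: M N)
qed

text \<open>Empirical measures are lifted to the real line through a coding of \<open>\<Omega>\<close>, where Helly's
  selection theorem applies, and the limit is pushed forward.\<close>

lemma empirical_measures_subconverge:
  fixes \<Omega> :: "'a::metric_space set" and y :: "nat \<Rightarrow> 'a"
  assumes \<Omega>: "compact \<Omega>" and y: "\<And>n. y n \<in> \<Omega>" and s: "strict_mono s"
  obtains r \<mu> where "strict_mono (r :: nat \<Rightarrow> nat)" "prob_space \<mu>"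
    "sets \<mu> = sets (restrict_space borel \<Omega>)"
    "\<And>g :: 'a \<Rightarrow> real. continuous_on \<Omega> g \<Longrightarrow>
      (\<lambda>n. (\<Sum>j<Suc (s (r n)). g (y j)) / real (Suc (s (r n)))) \<longlonglongrightarrow> integral\<^sup>L \<mu> g"
proof -
  have ne: "\<Omega> \<noteq> {}" using y by auto
  obtain e :: "'a \<Rightarrow> real" and K \<pi> where e: "\<And>x. 0 \<le> e x \<and> e x \<le> 2" and K: "closed K" "e ` \<Omega> \<subseteq> K"
    and \<pi>: "\<pi> \<in> K \<rightarrow> \<Omega>" "continuous_on K \<pi>" "\<And>x. x \<in> \<Omega> \<Longrightarrow> \<pi> (e x) = x"
    using exists_compact_coding[OF \<Omega> ne] by metis
  \<comment> \<open>The empirical measure of the first \<open>n + 1\<close> codes; the shift by one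
    avoids an empty sample. Its source carries all subsets, so discontinuity of \<open>e\<close>
    causes no measurability problem.\<close>
  define E where "E n = distr (uniform_count_measure {..<Suc n}) borel (\<lambda>j. e (y j))" for n
  have meas: "(\<lambda>j. e (y j)) \<in> measurable (uniform_count_measure {..<Suc n}) borel" for n
    by (simp add: measurable_def space_uniform_count_measure sets_uniform_count_measure)
  have fin: "finite {..<Suc n}" "{..<Suc n} \<noteq> {}" for n by auto
  have rd: "real_distribution (E n)" for n
    unfolding E_def
    by (intro real_distribution.intro prob_space.prob_space_distr prob_space_uniform_count_measure
        fin meas real_distribution_axioms.intro) auto
  have intE: "integral\<^sup>L (E n) G = (\<Sum>j<Suc n. G (e (y j))) / real (Suc n)"
    if "G \<in> borel_measurable borel" for n and G :: "real \<Rightarrow> real"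
    unfolding E_def integral_distr[OF meas that] integral_uniform_count_measure[OF fin(1)] by simp
  have "tight E" unfolding tight_def
  proof (intro conjI allI impI rd)
    fix \<epsilon> :: real assume \<epsilon>: "\<epsilon> > 0"
    have "measure (E n) {-1<..2} = 1" for n
    proof -
      interpret real_distribution "E n" by (rule rd)
      have "AE x in E n. x \<in> {-1<..2}"
        unfolding E_def by (subst AE_distr_iff[OF meas]) (use e in \<open>auto intro!: AE_I2 dest: order_trans[of _ 0] simp: less_le_trans[of "-1" 0]\<close>)
      then show ?thesis by (subst prob_eq_1) auto
    qed
    then show "\<exists>a b. a < b \<and> (\<forall>n. measure (E n) {a<..b} > 1 - \<epsilon>)"
      using \<epsilon> by (intro exI[of _ "-1"] exI[of _ 2]) auto
  qed
  then obtain r \<nu> where r: "strict_mono (r :: nat \<Rightarrow> nat)" and \<nu>: "real_distribution \<nu>"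
    and conv: "weak_conv_m (E \<circ> s \<circ> r) \<nu>"
    using tight_imp_convergent_subsubsequence[OF _ s] by blast
  interpret \<nu>: real_distribution \<nu> by (rule \<nu>)
  have conv_int: "(\<lambda>n. (\<Sum>j<Suc (s (r n)). G (e (y j))) / real (Suc (s (r n)))) \<longlonglongrightarrow> integral\<^sup>L \<nu> G"
    if G: "continuous_on UNIV G" "\<And>x. norm (G x) \<le> B" for G :: "real \<Rightarrow> real" and B
  proof -
    have "(\<lambda>n. integral\<^sup>L ((E \<circ> s \<circ> r) n) G) \<longlonglongrightarrow> integral\<^sup>L \<nu> G"
    proof (rule weak_conv_imp_integral_bdd_continuous_conv[OF _ \<nu> conv])
      show "real_distribution ((E \<circ> s \<circ> r) n)" for n using rd by simp
      show "isCont G x" for x using G(1) by (simp add: continuous_on_eq_continuous_at)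
    qed (rule G(2))
    moreover have "integral\<^sup>L ((E \<circ> s \<circ> r) n) G = (\<Sum>j<Suc (s (r n)). G (e (y j))) / real (Suc (s (r n)))" for n
      using intE[OF borel_measurable_continuous_onI[OF G(1)]] by (simp del: sum.lessThan_Suc)
    ultimately show ?thesis by simp
  qed
  have Kne: "K \<noteq> {}" using K(2) ne by auto
  have eK: "e (y j) \<in> K" for j using K(2) y by auto
  \<comment> \<open>The truncated distance to \<open>K\<close> is a bounded continuous function
    vanishing at every code, so its integral against the weak limit is 0.\<close>
  have AE_K: "AE x in \<nu>. x \<in> K"
  proof -
    let ?G = "\<lambda>x. min 1 (infdist x K)"
    have Gc: "continuous_on UNIV ?G" by (intro continuous_intros)
    have Gb: "norm (?G x) \<le> 1" for x using infdist_nonneg[of x K] by simp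
    have "integral\<^sup>L \<nu> ?G = 0"
      using conv_int[OF Gc Gb] eK by (simp add: LIMSEQ_const_iff del: sum.lessThan_Suc)
    moreover have "integrable \<nu> ?G"
      using Gb borel_measurable_continuous_onI[OF Gc] by (intro \<nu>.integrable_const_bound[of _ 1]) auto
    ultimately have "AE x in \<nu>. ?G x = 0"
      using integral_nonneg_eq_0_iff_AE[of \<nu> ?G] infdist_nonneg[of _ K] by simp
    then show ?thesis
      by eventually_elim (use in_closed_iff_infdist_zero[OF K(1) Kne] in \<open>auto simp: min_def split: if_splits\<close>)
  qed
  \<comment> \<open>The value \<open>y 0\<close> off \<open>K\<close> is a default in \<Omega>,
    taken only on a null set of the limit measure.\<close>
  define p where "p x = (if x \<in> K then \<pi> x else y 0)" for x
  have p: "p \<in> measurable borel (restrict_space borel \<Omega>)"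
  proof (rule measurable_restrict_space2)
    show "p \<in> space borel \<rightarrow> \<Omega>" using \<pi>(1) y by (auto simp: p_def)
    show "p \<in> measurable borel borel" unfolding p_def[abs_def]
      by (intro borel_measurable_continuous_on_if \<pi>(2) continuous_on_const borel_closed K(1))
  qed
  define \<mu> where "\<mu> = distr \<nu> (restrict_space borel \<Omega>) p"
  have p': "p \<in> measurable \<nu> (restrict_space borel \<Omega>)"
    using p measurable_cong_sets[OF \<nu>.events_eq_borel refl] by blast
  show thesis
  proof (rule that[OF r])
    show "prob_space \<mu>" unfolding \<mu>_def by (rule \<nu>.prob_space_distr[OF p'])
    show "sets \<mu> = sets (restrict_space borel \<Omega>)" by (simp add: \<mu>_def)
    fix g :: "'a \<Rightarrow> real" assume g: "continuous_on \<Omega> g"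
    have gm: "g \<in> borel_measurable (restrict_space borel \<Omega>)"
      by (rule borel_measurable_continuous_on_restrict[OF g])
    obtain B where B: "\<And>x. x \<in> \<Omega> \<Longrightarrow> norm (g x) \<le> B" "0 \<le> B"
    proof -
      have "bounded (g ` \<Omega>)" by (intro compact_imp_bounded compact_continuous_image g \<Omega>)
      then show thesis using that by (auto simp: bounded_pos intro: less_imp_le)
    qed
    \<comment> \<open>Weak convergence needs a bounded continuous test function on the whole line,
      whereas \<open>g (p x)\<close> may jump at the edge of \<open>K\<close>; a Tietze extension
      agrees with it on \<open>K\<close>, which contains all codes.\<close>
    obtain G where G: "continuous_on UNIV G" "\<And>x. x \<in> K \<Longrightarrow> G x = g (\<pi> x)" "\<And>x. norm (G x) \<le> B"
    proof (rule Tietze[of K "\<lambda>x. g (\<pi> x)" UNIV B])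
      show "continuous_on K (\<lambda>x. g (\<pi> x))" 
        by (rule continuous_on_compose2[OF g \<pi>(2)]) (use \<pi>(1) in auto)
      show "closedin (top_of_set UNIV) K" using K(1) by simp
      show "norm (g (\<pi> x)) \<le> B" if "x \<in> K" for x using B(1) \<pi>(1) that by auto
    qed (use B(2) in auto)
    have "integral\<^sup>L \<mu> g = (\<integral>x. g (p x) \<partial>\<nu>)" unfolding \<mu>_def by (rule integral_distr[OF p' gm])
    also have "\<dots> = integral\<^sup>L \<nu> G"
    proof (rule integral_cong_AE)
      show "(\<lambda>x. g (p x)) \<in> borel_measurable \<nu>" by (rule measurable_compose[OF p' gm])
      show "G \<in> borel_measurable \<nu>" using borel_measurable_continuous_onI[OF G(1)] by simp
      show "AE x in \<nu>. g (p x) = G x" using AE_K by eventually_elim (simp add: p_def G(2))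
    qed
    finally show "(\<lambda>n. (\<Sum>j<Suc (s (r n)). g (y j)) / real (Suc (s (r n)))) \<longlonglongrightarrow> integral\<^sup>L \<mu> g"
      using conv_int[OF G(1,3)] G(2)[OF eK] \<pi>(3)[OF y] by (simp del: sum.lessThan_Suc)
  qed
qed

text \<open>Averages that stayed \<epsilon> away from the integral along a subsequence would have a
  further subsequence whose empirical measures converge. The limit is invariant, hence is the unique
  invariant measure, which contradicts the distance \<epsilon>.\<close>

lemma uniquely_ergodic_birkhoff:
  fixes \<Omega> :: "'a::metric_space set" and g :: "'a \<Rightarrow> real"
  assumes ue: "uniquely_ergodic \<Omega> \<Theta>" and g: "continuous_on \<Omega> g"
  shows "\<exists>I. \<forall>\<omega>\<in>\<Omega>. (\<lambda>n. (\<Sum>j<n. g ((\<Theta> ^^ j) \<omega>)) / real n) \<longlonglongrightarrow> I"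
proof -
  have \<Omega>: "compact \<Omega>" and \<Theta>: "\<Theta> \<in> \<Omega> \<rightarrow> \<Omega>" "continuous_on \<Omega> \<Theta>"
    and uniq: "\<exists>!\<mu>. invariant_prob \<Omega> \<Theta> \<mu>" using ue by (auto simp: uniquely_ergodic_def)
  obtain \<mu>0 where \<mu>0: "\<And>\<mu>. invariant_prob \<Omega> \<Theta> \<mu> \<Longrightarrow> \<mu> = \<mu>0" using uniq by blast
  let ?A = "\<lambda>\<omega> g n. (\<Sum>j<n. g ((\<Theta> ^^ j) \<omega>)) / real n"
  have "?A \<omega> g \<longlonglongrightarrow> integral\<^sup>L \<mu>0 g" if \<omega>: "\<omega> \<in> \<Omega>" for \<omega>
  proof (rule ccontr)
    have iter: "(\<Theta> ^^ n) \<omega> \<in> \<Omega>" for n using \<omega> \<Theta>(1) by (induction n) auto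
    assume "\<not> ?A \<omega> g \<longlonglongrightarrow> integral\<^sup>L \<mu>0 g"
    then have "\<not> (\<lambda>n. ?A \<omega> g (Suc n)) \<longlonglongrightarrow> integral\<^sup>L \<mu>0 g"
      using LIMSEQ_imp_Suc[of "?A \<omega> g" "integral\<^sup>L \<mu>0 g"] by blast
    then obtain \<epsilon> where \<epsilon>: "\<epsilon> > 0" "\<And>N. \<exists>n\<ge>N. \<epsilon> \<le> dist (?A \<omega> g (Suc n)) (integral\<^sup>L \<mu>0 g)"
      unfolding lim_sequentially by (meson not_less)
    then have "infinite {n. \<epsilon> \<le> dist (?A \<omega> g (Suc n)) (integral\<^sup>L \<mu>0 g)}"
      unfolding infinite_nat_iff_unbounded_le by auto
    then obtain s where s: "strict_mono (s :: nat \<Rightarrow> nat)"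
        "\<And>n. \<epsilon> \<le> dist (?A \<omega> g (Suc (s n))) (integral\<^sup>L \<mu>0 g)"
      using infinite_enumerate by blast
    obtain r \<mu> where r: "strict_mono (r :: nat \<Rightarrow> nat)" and \<mu>: "prob_space \<mu>"
      and sets: "sets \<mu> = sets (restrict_space borel \<Omega>)"
      and lim: "\<And>g :: 'a \<Rightarrow> real. continuous_on \<Omega> g \<Longrightarrow> (\<lambda>n. ?A \<omega> g (Suc (s (r n)))) \<longlonglongrightarrow> integral\<^sup>L \<mu> g"
      by (rule empirical_measures_subconverge[of \<Omega> "\<lambda>n. (\<Theta> ^^ n) \<omega>" s])
        (use \<Omega> iter s(1) in \<open>auto simp del: sum.lessThan_Suc\<close>)
    interpret \<mu>: prob_space \<mu> by (rule \<mu>)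
    have \<Theta>m: "\<Theta> \<in> measurable \<mu> \<mu>"
    proof -
      have "\<Theta> \<in> measurable (restrict_space borel \<Omega>) (restrict_space borel \<Omega>)"
        by (intro measurable_restrict_space2 borel_measurable_continuous_on_restrict \<Theta>(2))
          (use \<Theta>(1) in \<open>auto simp: space_restrict_space\<close>)
      then show ?thesis using measurable_cong_sets[OF sets sets] by blast
    qed
    have inv: "integral\<^sup>L (distr \<mu> \<mu> \<Theta>) u = integral\<^sup>L \<mu> u" if u: "continuous_on \<Omega> u" for u :: "'a \<Rightarrow> real"
    proof -
      have um: "u \<in> borel_measurable \<mu>"
        using borel_measurable_continuous_on_restrict[OF u] measurable_cong_sets[OF sets refl] by blast
      obtain B where B: "\<And>x. x \<in> \<Omega> \<Longrightarrow> norm (u x) \<le> B"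
      proof -
        have "bounded (u ` \<Omega>)" by (intro compact_imp_bounded compact_continuous_image u \<Omega>)
        then show thesis using that by (auto simp: bounded_iff)
      qed
      have u\<Theta>: "continuous_on \<Omega> (\<lambda>x. u (\<Theta> x))"
        by (rule continuous_on_compose2[OF u \<Theta>(2)]) (use \<Theta>(1) in auto)
      let ?N = "\<lambda>n. Suc (s (r n))"
      have N: "filterlim ?N at_top sequentially"
        using filterlim_subseq[OF strict_mono_o[OF s(1) r]] filterlim_Suc
        by (auto simp: o_def intro: filterlim_compose)
      \<comment> \<open>Moving the average one step along the orbit changes only its two end terms;
        after division by \<open>n\<close> this is what makes the limit measure invariant.\<close>
      have diff: "?A \<omega> (\<lambda>x. u (\<Theta> x)) n - ?A \<omega> u n = (u ((\<Theta> ^^ n) \<omega>) - u \<omega>) / real n" for n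
      proof -
        have "(\<Sum>j<n. u (\<Theta> ((\<Theta> ^^ j) \<omega>))) - (\<Sum>j<n. u ((\<Theta> ^^ j) \<omega>)) = u ((\<Theta> ^^ n) \<omega>) - u \<omega>"
          by (induction n) auto
        then show ?thesis by (simp flip: diff_divide_distrib)
      qed
      have "(\<lambda>n. (u ((\<Theta> ^^ n) \<omega>) - u \<omega>) / real n) \<longlonglongrightarrow> 0"
      proof (rule Lim_null_comparison)
        show "\<forall>\<^sub>F n in sequentially. norm ((u ((\<Theta> ^^ n) \<omega>) - u \<omega>) / real n) \<le> (2 * B) / real n"
        proof (intro always_eventually allI)
          fix n
          have "norm (u ((\<Theta> ^^ n) \<omega>) - u \<omega>) \<le> 2 * B"
            using B[OF iter[of n]] B[OF \<omega>] norm_triangle_ineq4[of "u ((\<Theta> ^^ n) \<omega>)" "u \<omega>"] by linarith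
          then show "norm ((u ((\<Theta> ^^ n) \<omega>) - u \<omega>) / real n) \<le> (2 * B) / real n"
            by (simp add: norm_divide divide_right_mono)
        qed
        show "(\<lambda>n. 2 * B / real n) \<longlonglongrightarrow> 0"
          by (intro tendsto_divide_0[OF tendsto_const] filterlim_at_top_imp_at_infinity filterlim_real_sequentially)
      qed
      then have "(\<lambda>n. ?A \<omega> (\<lambda>x. u (\<Theta> x)) (?N n) - ?A \<omega> u (?N n)) \<longlonglongrightarrow> 0"
        unfolding diff using N by (rule filterlim_compose)
      moreover have "(\<lambda>n. ?A \<omega> (\<lambda>x. u (\<Theta> x)) (?N n) - ?A \<omega> u (?N n))
          \<longlonglongrightarrow> (\<integral>x. u (\<Theta> x) \<partial>\<mu>) - integral\<^sup>L \<mu> u"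
        by (intro tendsto_diff lim u u\<Theta>)
      ultimately have "(\<integral>x. u (\<Theta> x) \<partial>\<mu>) = integral\<^sup>L \<mu> u" using LIMSEQ_unique by fastforce
      then show ?thesis by (simp add: integral_distr[OF \<Theta>m um])
    qed
    have "distr \<mu> \<mu> \<Theta> = \<mu>"
      using \<mu>.finite_measure_axioms prob_space.finite_measure[OF \<mu>.prob_space_distr[OF \<Theta>m]] sets inv
      by (intro closed_space_measure_eqI[of _ \<Omega>]) auto
    then have "\<mu> = \<mu>0" using sets \<mu> by (intro \<mu>0) (simp add: invariant_prob_def)
    then have "(\<lambda>n. dist (?A \<omega> g (Suc (s (r n)))) (integral\<^sup>L \<mu>0 g)) \<longlonglongrightarrow> dist (integral\<^sup>L \<mu>0 g) (integral\<^sup>L \<mu>0 g)"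
      using lim[OF g] by (intro tendsto_intros) simp
    then have "\<forall>\<^sub>F n in sequentially. dist (?A \<omega> g (Suc (s (r n)))) (integral\<^sup>L \<mu>0 g) < \<epsilon>"
      using \<epsilon>(1) by (intro order_tendstoD) auto
    then show False using s(2) eventually_happens'[OF sequentially_bot] by (meson not_less)
  qed
  then show ?thesis by blast
qed

section \<open>Partition functions of finite-range observables\<close>

lemma funpow_shift_map: "(shift_map ^^ k) x = (\<lambda>i. x (k + i))"
  by (induction k) (auto simp: shift_map_def fun_eq_iff)

text \<open>Each ratio of summands lies between \<open>exp (-D)\<close> and \<open>exp D\<close>.
  This turns uniform energy differences into additive errors of log partition functions.\<close>

lemma ln_sum_exp_diff_le:
  fixes u v :: "'i \<Rightarrow> real"
  assumes A: "finite A" "A \<noteq> {}" and uv: "\<And>x. x \<in> A \<Longrightarrow> \<bar>u x - v x\<bar> \<le> D"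
  shows "\<bar>ln (\<Sum>x\<in>A. exp (u x)) - ln (\<Sum>x\<in>A. exp (v x))\<bar> \<le> D"
proof -
  have "ln (\<Sum>x\<in>A. exp (u x)) \<le> ln (\<Sum>x\<in>A. exp (v x)) + D"
    if "\<And>x. x \<in> A \<Longrightarrow> \<bar>u x - v x\<bar> \<le> D" for u v :: "'i \<Rightarrow> real"
  proof -
    have pos: "0 < (\<Sum>x\<in>A. exp (w x))" for w :: "'i \<Rightarrow> real" using A by (intro sum_pos) auto
    have "(\<Sum>x\<in>A. exp (u x)) \<le> (\<Sum>x\<in>A. exp (v x) * exp D)"
    proof (intro sum_mono)
      fix x assume "x \<in> A"
      then have "u x \<le> v x + D" using that[of x] by linarith
      then show "exp (u x) \<le> exp (v x) * exp D" by (simp flip: exp_add)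
    qed
    then have "ln (\<Sum>x\<in>A. exp (u x)) \<le> ln ((\<Sum>x\<in>A. exp (v x)) * exp D)"
      unfolding sum_distrib_right[symmetric] using pos by (subst ln_le_cancel_iff) auto
    also have "\<dots> = ln (\<Sum>x\<in>A. exp (v x)) + D" using pos[of v] by (simp add: ln_mult)
    finally show ?thesis .
  qed
  from this[of u v] this[of v u] show ?thesis using uv by (simp add: abs_minus_commute abs_le_iff)
qed

text \<open>The symbol \<open>s0\<close> serves for padding; \<open>m\<close> is a window length
  beyond which \<open>f\<close> reads nothing, taken positive so that
  \<open>n \<le> n * m\<close>.\<close>

locale finite_range_observable =
  fixes S :: "'s set" and s0 :: 's and f :: "(nat \<Rightarrow> 's) \<Rightarrow> real" and m :: nat and F :: real
  assumes fin: "finite S" and s0: "s0 \<in> S" and m: "m > 0"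
    and dep: "\<And>x y. \<lbrakk>x \<in> UNIV \<rightarrow> S; y \<in> UNIV \<rightarrow> S; \<And>i. i < m \<Longrightarrow> x i = y i\<rbrakk> \<Longrightarrow> f x = f y"
    and f_le: "\<And>x. x \<in> UNIV \<rightarrow> S \<Longrightarrow> \<bar>f x\<bar> \<le> F"
begin

text \<open>Words of length \<open>N\<close>, padded with \<open>s0\<close> to infinite sequences.\<close>

definition words :: "nat \<Rightarrow> (nat \<Rightarrow> 's) set" where
  "words N = {x \<in> UNIV \<rightarrow> S. \<forall>k\<ge>N. x k = s0}"

text \<open>The weights \<open>h\<close> along the orbit are abstracted to an arbitrary real
  sequence \<open>c\<close>, so that moving along the orbit becomes an index shift and estimates
  depend on a bound for \<open>c\<close> only.\<close>

definition energy :: "nat \<Rightarrow> (nat \<Rightarrow> real) \<Rightarrow> (nat \<Rightarrow> 's) \<Rightarrow> real" where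
  "energy n c x = (\<Sum>k<n. c k * f ((shift_map ^^ k) x))"

lemma words_subset: "x \<in> words N \<Longrightarrow> x \<in> UNIV \<rightarrow> S"
  by (simp add: words_def)

lemma comb_seq_in: "x \<in> UNIV \<rightarrow> S \<Longrightarrow> y \<in> UNIV \<rightarrow> S \<Longrightarrow> comb_seq n x y \<in> UNIV \<rightarrow> S"
  by (simp add: comb_seq_def Pi_iff)

lemma shift_in: "x \<in> UNIV \<rightarrow> S \<Longrightarrow> (shift_map ^^ k) x \<in> UNIV \<rightarrow> S"
  by (auto simp: funpow_shift_map)

lemma bij_betw_words: "bij_betw (\<lambda>x. restrict x {..<N}) (words N) ({..<N} \<rightarrow>\<^sub>E S)"
proof (rule bij_betw_byWitness[where f' = "\<lambda>y k. if k < N then y k else s0"])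
  show "\<forall>x\<in>words N. (\<lambda>k. if k < N then restrict x {..<N} k else s0) = x"
    by (auto simp: words_def fun_eq_iff)
  show "\<forall>y\<in>{..<N} \<rightarrow>\<^sub>E S. restrict (\<lambda>k. if k < N then y k else s0) {..<N} = y"
  proof (intro ballI ext)
    fix y k assume "y \<in> {..<N} \<rightarrow>\<^sub>E S"
    then show "restrict (\<lambda>k. if k < N then y k else s0) {..<N} k = y k"
      using PiE_arb[of y "{..<N}" "\<lambda>_. S" k] by (cases "k < N") simp_all
  qed
  show "(\<lambda>x. restrict x {..<N}) ` words N \<subseteq> {..<N} \<rightarrow>\<^sub>E S"
    by (simp add: words_def Pi_iff PiE_iff image_subset_iff)
  show "(\<lambda>y k. if k < N then y k else s0) ` ({..<N} \<rightarrow>\<^sub>E S) \<subseteq> words N"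
    using s0 by (simp add: words_def Pi_iff PiE_iff image_subset_iff)
qed

lemma finite_words: "finite (words N)"
  using bij_betw_finite[OF bij_betw_words] by (simp add: finite_PiE fin)

lemma card_words: "card (words N) = card S ^ N"
  using bij_betw_same_card[OF bij_betw_words] by (simp add: card_PiE)

lemma words_nonempty: "words N \<noteq> {}"
  using s0 by (auto simp: words_def intro!: exI[of _ "\<lambda>_. s0"])

lemma words_0: "words 0 = {\<lambda>_. s0}"
  by (auto simp: words_def s0)

lemma comb_seq_prefix_tail: "comb_seq N (comb_seq N z u) (\<lambda>k. z (N + k)) = z"
  by (auto simp: comb_seq_def fun_eq_iff)

lemma sum_words_add:
  "(\<Sum>z\<in>words (N + M). g z) = (\<Sum>x\<in>words N. \<Sum>y\<in>words M. g (comb_seq N x y))"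
  unfolding sum.cartesian_product
  by (rule sum.reindex_bij_witness[where j = "\<lambda>z. (comb_seq N z (\<lambda>_. s0), \<lambda>k. z (N + k))"
        and i = "\<lambda>(x, y). comb_seq N x y"])
    (auto simp: comb_seq_prefix_tail words_def comb_seq_def s0 fun_eq_iff Pi_iff)

lemma integral_eq_sum_words:
  fixes g :: "(nat \<Rightarrow> 's) \<Rightarrow> real"
  assumes g: "\<And>x y. \<lbrakk>x \<in> UNIV \<rightarrow> S; y \<in> UNIV \<rightarrow> S; \<And>i. i < N \<Longrightarrow> x i = y i\<rbrakk> \<Longrightarrow> g x = g y"
  shows "integral\<^sup>L (uniform_bernoulli S) g = (\<Sum>x\<in>words N. g x) / real (card S) ^ N"
proof -
  let ?M = "uniform_bernoulli S"
  define C where "C w = {y \<in> UNIV \<rightarrow> S. \<forall>k<N. y k = w k}" for w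
  have q: "card S > 0" using fin s0 by (auto simp: card_gt_0_iff)
  have C_meas: "measure ?M (C w) = 1 / real (card S) ^ N" if "w \<in> words N" for w
    unfolding C_def using fin words_subset[OF that] by (rule measure_uniform_bernoulli_cylinder)
  \<comment> \<open>Measurability and finiteness are read off from the positive value of
    \<open>measure\<close>, which is 0 both for nonmeasurable sets and for infinite mass.\<close>
  have C_sets: "C w \<in> sets ?M" "emeasure ?M (C w) < \<infinity>" if "w \<in> words N" for w
  proof -
    have "measure ?M (C w) \<noteq> 0" using C_meas[OF that] q by simp
    then show "C w \<in> sets ?M" using measure_notin_sets by blast
    from \<open>measure ?M (C w) \<noteq> 0\<close> have "emeasure ?M (C w) \<noteq> \<top>" by (auto simp: measure_def)
    then show "emeasure ?M (C w) < \<infinity>" by (simp add: less_top)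
  qed
  have g_eq: "g y = (\<Sum>w\<in>words N. g w * indicator (C w) y)" if y: "y \<in> UNIV \<rightarrow> S" for y
  proof -
    let ?w = "comb_seq N y (\<lambda>_. s0)"
    have w: "?w \<in> words N" using y s0 by (auto simp: words_def comb_seq_def)
    have "(\<Sum>w\<in>words N. g w * indicator (C w) y) = (\<Sum>w\<in>words N. if w = ?w then g ?w else 0)"
    proof (intro sum.cong refl)
      fix w assume "w \<in> words N"
      then have "y \<in> C w \<longleftrightarrow> w = ?w" using y by (auto simp: C_def words_def comb_seq_def fun_eq_iff)
      then show "g w * indicator (C w) y = (if w = ?w then g ?w else 0)" by auto
    qed
    also have "\<dots> = g ?w" using w by (simp add: finite_words)
    also have "\<dots> = g y" using y words_subset[OF w] by (intro g) (auto simp: comb_seq_def)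
    finally show ?thesis by simp
  qed
  have "integral\<^sup>L ?M g = (\<integral>y. (\<Sum>w\<in>words N. g w * indicator (C w) y) \<partial>?M)"
    using g_eq by (intro Bochner_Integration.integral_cong) (auto simp: space_uniform_bernoulli)
  also have "\<dots> = (\<Sum>w\<in>words N. \<integral>y. g w * indicator (C w) y \<partial>?M)"
    by (intro Bochner_Integration.integral_sum integrable_mult_right integrable_real_indicator C_sets)
  also have "\<dots> = (\<Sum>w\<in>words N. g w * measure ?M (C w))"
  proof (intro sum.cong refl)
    fix w assume "w \<in> words N"
    have "C w \<inter> space ?M = C w" by (auto simp: C_def space_uniform_bernoulli)
    then show "(\<integral>y. g w * indicator (C w) y \<partial>?M) = g w * measure ?M (C w)" by simp
  qed
  also have "\<dots> = (\<Sum>w\<in>words N. g w) / real (card S) ^ N" by (simp add: C_meas sum_divide_distrib)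
  finally show ?thesis .
qed

lemma energy_cong:
  assumes "x \<in> UNIV \<rightarrow> S" "y \<in> UNIV \<rightarrow> S" "\<And>i. i < n + m \<Longrightarrow> x i = y i"
  shows "energy n c x = energy n c y"
  unfolding energy_def using assms
  by (intro sum.cong refl arg_cong2[where f = "(*)"] dep shift_in) (auto simp: funpow_shift_map)

lemma energy_bound:
  assumes "x \<in> UNIV \<rightarrow> S" "\<And>i. \<bar>c i\<bar> \<le> H"
  shows "\<bar>energy n c x\<bar> \<le> real n * (H * F)"
proof -
  have "\<bar>energy n c x\<bar> \<le> (\<Sum>k<n. H * F)" unfolding energy_def
  proof (intro order_trans[OF sum_abs] sum_mono)
    fix k
    show "\<bar>c k * f ((shift_map ^^ k) x)\<bar> \<le> H * F"
      unfolding abs_mult using assms(2)[of k] f_le[OF shift_in[OF assms(1)]]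
      by (intro mult_mono) auto
  qed
  then show ?thesis by simp
qed

lemma energy_add:
  "energy (n + k) c x = energy n c x + energy k (\<lambda>i. c (n + i)) (\<lambda>i. x (n + i))"
proof -
  have "(\<Sum>j<n + k. g j) = (\<Sum>j<n. g j) + (\<Sum>j<k. g (n + j))" for g :: "nat \<Rightarrow> real"
    by (induction k) auto
  then show ?thesis by (simp add: energy_def funpow_shift_map add.assoc)
qed

text \<open>Only the windows starting in the last \<open>m\<close> positions can look beyond
  coordinate \<open>n\<close>; each contributes at most \<open>2 * H * F\<close>, independently of
  \<open>n\<close>.\<close>

lemma energy_boundary:
  assumes x: "x \<in> UNIV \<rightarrow> S" and y: "y \<in> UNIV \<rightarrow> S" and eq: "\<And>i. i < n \<Longrightarrow> x i = y i"
    and c: "\<And>i. \<bar>c i\<bar> \<le> H"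
  shows "\<bar>energy n c x - energy n c y\<bar> \<le> 2 * real m * (H * F)"
proof -
  have HF: "0 \<le> H" "0 \<le> F" using c[of 0] f_le[OF x] by linarith+
  have "energy n c x - energy n c y
      = (\<Sum>k<n. c k * (f ((shift_map ^^ k) x) - f ((shift_map ^^ k) y)))"
    by (simp add: energy_def sum_subtractf right_diff_distrib)
  also have "\<bar>\<dots>\<bar> \<le> (\<Sum>k<n. if n < k + m then H * (2 * F) else 0)"
  proof (intro order_trans[OF sum_abs] sum_mono)
    fix k assume "k \<in> {..<n}"
    show "\<bar>c k * (f ((shift_map ^^ k) x) - f ((shift_map ^^ k) y))\<bar> \<le> (if n < k + m then H * (2 * F) else 0)"
    proof (cases "n < k + m")
      case True
      have "\<bar>f ((shift_map ^^ k) x) - f ((shift_map ^^ k) y)\<bar> \<le> 2 * F"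
        using f_le[OF shift_in[OF x, of k]] f_le[OF shift_in[OF y, of k]] by linarith
      then have "\<bar>c k * (f ((shift_map ^^ k) x) - f ((shift_map ^^ k) y))\<bar> \<le> H * (2 * F)"
        unfolding abs_mult using c[of k] HF by (intro mult_mono) auto
      then show ?thesis using True by simp
    next
      case False
      then have "f ((shift_map ^^ k) x) = f ((shift_map ^^ k) y)"
        using x y eq by (intro dep shift_in) (auto simp: funpow_shift_map)
      then show ?thesis using False by simp
    qed
  qed
  also have "\<dots> = real (card {k \<in> {..<n}. n < k + m}) * (H * (2 * F))"
    by (simp add: sum.inter_filter[symmetric])
  also have "\<dots> \<le> real m * (H * (2 * F))"
  proof -
    have "{k \<in> {..<n}. n < k + m} \<subseteq> {n - m..<n}" by auto
    then have "card {k \<in> {..<n}. n < k + m} \<le> card {n - m..<n}" by (intro card_mono) auto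
    then have "card {k \<in> {..<n}. n < k + m} \<le> m" by simp
    then show ?thesis using HF by (intro mult_right_mono) auto
  qed
  finally show ?thesis by (simp add: mult.assoc mult.left_commute)
qed

section \<open>Real partition sums and almost additivity\<close>

text \<open>Words have length \<open>n\<close> although the energy reads further, the last windows
  seeing the padding. Concatenation then splits words exactly, and the discrepancy with the integral
  is a boundary effect.\<close>

definition partition_sum :: "real \<Rightarrow> nat \<Rightarrow> (nat \<Rightarrow> real) \<Rightarrow> real" where
  "partition_sum l n c = (\<Sum>x\<in>words n. exp (l * energy n c x))"

lemma partition_sum_pos: "0 < partition_sum l n c"
  unfolding partition_sum_def using finite_words words_nonempty by (intro sum_pos) auto

lemma energy_comb_seq_diff:
  assumes x: "x \<in> UNIV \<rightarrow> S" and y: "y \<in> UNIV \<rightarrow> S" and c: "\<And>i. \<bar>c i\<bar> \<le> H"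
  shows "\<bar>l * energy n c (comb_seq n x y) - l * energy n c x\<bar> \<le> \<bar>l\<bar> * (2 * real m * (H * F))"
proof -
  have "\<bar>energy n c (comb_seq n x y) - energy n c x\<bar> \<le> 2 * real m * (H * F)"
    using x y c by (intro energy_boundary comb_seq_in) (auto simp: comb_seq_def)
  then show ?thesis by (simp add: abs_mult mult_left_mono flip: right_diff_distrib)
qed

text \<open>In a concatenation the second factor keeps its energy exactly; only the end of the first
  sees \<open>y\<close> instead of the padding.\<close>

lemma partition_sum_almost_additive:
  assumes c: "\<And>i. \<bar>c i\<bar> \<le> H"
  shows "\<bar>ln (partition_sum l (n + k) c) - ln (partition_sum l n c)
      - ln (partition_sum l k (\<lambda>i. c (n + i)))\<bar> \<le> \<bar>l\<bar> * (2 * real m * (H * F))"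
proof -
  let ?E = "\<lambda>y. l * energy k (\<lambda>i. c (n + i)) y"
  have "partition_sum l (n + k) c
      = (\<Sum>(x, y)\<in>words n \<times> words k. exp (l * energy n c (comb_seq n x y) + ?E y))"
    unfolding partition_sum_def sum_words_add sum.cartesian_product
    by (simp add: energy_add comb_seq_def distrib_left)
  moreover have prod: "partition_sum l n c * partition_sum l k (\<lambda>i. c (n + i))
      = (\<Sum>(x, y)\<in>words n \<times> words k. exp (l * energy n c x + ?E y))"
    by (simp add: partition_sum_def sum_product sum.cartesian_product exp_add)
  moreover have "\<bar>ln (\<Sum>z\<in>words n \<times> words k. exp (l * energy n c (comb_seq n (fst z) (snd z)) + ?E (snd z)))
      - ln (\<Sum>z\<in>words n \<times> words k. exp (l * energy n c (fst z) + ?E (snd z)))\<bar> \<le> \<bar>l\<bar> * (2 * real m * (H * F))"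
    using energy_comb_seq_diff[OF words_subset words_subset c, of _ n _ k l n] words_nonempty
    by (intro ln_sum_exp_diff_le) (auto simp: finite_words)
  moreover have "ln (partition_sum l n c * partition_sum l k (\<lambda>i. c (n + i)))
      = ln (partition_sum l n c) + ln (partition_sum l k (\<lambda>i. c (n + i)))"
    by (intro ln_mult_pos partition_sum_pos)
  ultimately show ?thesis by (simp add: case_prod_unfold diff_diff_eq)
qed

text \<open>The integral needs \<open>m\<close> further coordinates. Neglecting them in the energy
  costs a boundary term, and their free summation gives \<open>card S ^ m\<close>, which reduces the
  normalisation to \<open>card S ^ n\<close>.\<close>

lemma ln_integral_partition_sum:
  assumes c: "\<And>i. \<bar>c i\<bar> \<le> H"
  shows "\<bar>ln (\<integral>x. exp (l * energy n c x) \<partial>uniform_bernoulli S)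
      - (ln (partition_sum l n c) - real n * ln (real (card S)))\<bar> \<le> \<bar>l\<bar> * (2 * real m * (H * F))"
proof -
  let ?q = "real (card S)"
  have q: "?q > 0" using fin s0 by (auto simp: card_gt_0_iff)
  let ?Z = "\<Sum>z\<in>words n \<times> words m. exp (l * energy n c (comb_seq n (fst z) (snd z)))"
  have Z: "?Z > 0" using finite_words words_nonempty by (intro sum_pos) auto
  have "(\<integral>x. exp (l * energy n c x) \<partial>uniform_bernoulli S) = (\<Sum>x\<in>words (n + m). exp (l * energy n c x)) / ?q ^ (n + m)"
    by (rule integral_eq_sum_words) (use energy_cong in metis)
  also have "(\<Sum>x\<in>words (n + m). exp (l * energy n c x)) = ?Z"
    unfolding sum_words_add sum.cartesian_product by (simp add: case_prod_unfold)
  finally have "ln (\<integral>x. exp (l * energy n c x) \<partial>uniform_bernoulli S) = ln ?Z - real (n + m) * ln ?q"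
    using Z q by (simp add: ln_div ln_realpow)
  moreover have "\<bar>ln ?Z - ln (\<Sum>z\<in>words n \<times> words m. exp (l * energy n c (fst z)))\<bar> \<le> \<bar>l\<bar> * (2 * real m * (H * F))"
    using energy_comb_seq_diff[OF words_subset words_subset c, of _ n _ m l n] words_nonempty
    by (intro ln_sum_exp_diff_le) (auto simp: finite_words)
  moreover have "(\<Sum>z\<in>words n \<times> words m. exp (l * energy n c (fst z))) = partition_sum l n c * ?q ^ m"
  proof -
    have "(\<Sum>z\<in>words n \<times> words m. exp (l * energy n c (fst z)))
        = (\<Sum>x\<in>words n. \<Sum>y\<in>words m. exp (l * energy n c x))"
      unfolding sum.cartesian_product by (simp add: case_prod_unfold)
    then show ?thesis by (simp add: card_words partition_sum_def sum_distrib_left mult.commute)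
  qed
  ultimately show ?thesis
    using partition_sum_pos[of l n c] q by (simp add: ln_mult ln_realpow algebra_simps)
qed

section \<open>Complex moment generating functions and their zeros\<close>

text \<open>The entire extension of the integral in the parameter. Words of length
  \<open>n * m + m\<close> are longer than \<open>n + m\<close> in general, so that they divide into
  \<open>n\<close> blocks of length \<open>m\<close> and a final one; averaging over surplus
  coordinates changes nothing.\<close>

definition complex_mgf :: "nat \<Rightarrow> (nat \<Rightarrow> real) \<Rightarrow> complex \<Rightarrow> complex" where
  "complex_mgf n c l = (\<Sum>x\<in>words (n * m + m). exp (l * of_real (energy n c x))) / of_nat (card S) ^ (n * m + m)"

lemma complex_mgf_of_real:
  "complex_mgf n c (of_real l) = of_real (\<integral>x. exp (l * energy n c x) \<partial>uniform_bernoulli S)"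
proof -
  have le: "n \<le> n * m" using m by simp
  have "energy n c x = energy n c y"
    if "x \<in> UNIV \<rightarrow> S" "y \<in> UNIV \<rightarrow> S" "\<And>i. i < n * m + m \<Longrightarrow> x i = y i" for x y
    by (rule energy_cong[OF that(1,2)], rule that(3)) (use le in linarith)
  then have "(\<integral>x. exp (l * energy n c x) \<partial>uniform_bernoulli S)
      = (\<Sum>x\<in>words (n * m + m). exp (l * energy n c x)) / real (card S) ^ (n * m + m)"
    by (intro integral_eq_sum_words) metis
  then show ?thesis by (simp add: complex_mgf_def flip: of_real_mult exp_of_real)
qed

lemma complex_mgf_holomorphic: "complex_mgf n c holomorphic_on A"
  unfolding complex_mgf_def[abs_def] using fin s0
  by (intro holomorphic_intros) (auto simp: card_gt_0_iff)

lemma norm_complex_mgf_le: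
  assumes c: "\<And>i. \<bar>c i\<bar> \<le> H" and l: "norm l \<le> L"
  shows "norm (complex_mgf n c l) \<le> exp (L * (H * F) * real n)"
proof -
  let ?N = "n * m + m"
  have q: "card S > 0" using fin s0 by (auto simp: card_gt_0_iff)
  have HF: "0 \<le> H * F" using c[of 0] f_le[of "\<lambda>_. s0"] s0 by (intro mult_nonneg_nonneg) force+
  have "norm (exp (l * of_real (energy n c x))) \<le> exp (L * (H * F) * real n)" if x: "x \<in> words ?N" for x
  proof -
    have "norm (exp (l * of_real (energy n c x))) \<le> exp (norm (l * of_real (energy n c x)))" by (rule norm_exp)
    also have "norm (l * of_real (energy n c x)) \<le> L * (real n * (H * F))"
      unfolding norm_mult using energy_bound[OF words_subset[OF x] c] l order_trans[OF norm_ge_zero l]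
      by (intro mult_mono) auto
    finally show ?thesis by (simp add: mult_ac)
  qed
  then have "norm (\<Sum>x\<in>words ?N. exp (l * of_real (energy n c x))) \<le> (\<Sum>x\<in>words ?N. exp (L * (H * F) * real n))"
    by (rule sum_norm_le)
  then show ?thesis using q
    by (simp add: complex_mgf_def norm_divide norm_power card_words divide_le_eq mult.commute)
qed

text \<open>Grouping the coordinates into blocks of length \<open>m\<close> leaves only nearest-neighbour interactions
  between blocks.\<close>

lemma transfer_iter_eq_sum_words:
  fixes l :: complex
  assumes y: "y \<in> UNIV \<rightarrow> S"
  shows "(\<Sum>x\<in>words (J * m). exp (l * of_real (energy (J * m) c (comb_seq (J * m) x y))))
    = transfer_iter (words m)
        (\<lambda>j b y. exp (l * of_real (energy m (\<lambda>i. c (j * m + i)) (comb_seq m b y)))) J y"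
  using y
proof (induction J arbitrary: y)
  case 0
  show ?case by (simp add: words_0 energy_def)
next
  case (Suc J)
  let ?e = "\<lambda>b. l * of_real (energy m (\<lambda>i. c (J * m + i)) (comb_seq m b y))"
  have "exp (l * of_real (energy (J * m + m) c (comb_seq (J * m + m) (comb_seq (J * m) x b) y)))
      = exp (l * of_real (energy (J * m) c (comb_seq (J * m) x b))) * exp (?e b)"
    if x: "x \<in> words (J * m)" and b: "b \<in> words m" for x b
  proof -
    have tail: "(\<lambda>i. comb_seq (J * m + m) (comb_seq (J * m) x b) y (J * m + i)) = comb_seq m b y"
      by (auto simp: comb_seq_def fun_eq_iff)
    \<comment> \<open>A window starting in one of the first \<open>J\<close> blocks has length at
      most \<open>m\<close> and so ends inside the block \<open>b\<close>; the continuation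
      \<open>y\<close> is not read.\<close>
    have "energy (J * m) c (comb_seq (J * m + m) (comb_seq (J * m) x b) y) = energy (J * m) c (comb_seq (J * m) x b)"
      by (intro energy_cong comb_seq_in words_subset[OF x] words_subset[OF b] Suc.prems)
        (simp add: comb_seq_def)
    then show ?thesis unfolding energy_add tail by (simp add: distrib_left exp_add)
  qed
  then have "(\<Sum>x\<in>words (Suc J * m). exp (l * of_real (energy (Suc J * m) c (comb_seq (Suc J * m) x y))))
      = (\<Sum>x\<in>words (J * m). \<Sum>b\<in>words m.
          exp (l * of_real (energy (J * m) c (comb_seq (J * m) x b))) * exp (?e b))"
    by (simp add: add.commute[of m] sum_words_add)
  also have "\<dots> = (\<Sum>b\<in>words m. exp (?e b) *
      (\<Sum>x\<in>words (J * m). exp (l * of_real (energy (J * m) c (comb_seq (J * m) x b)))))"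
    by (subst sum.swap) (simp add: sum_distrib_left mult.commute)
  finally show ?case using Suc.IH[OF words_subset] by simp
qed

text \<open>The final block is the state \<open>y\<close> of the matrix product, and the energy of
  one block is bounded by \<open>m * H * F\<close> in modulus. Since only this bound enters, the
  radius serves every coefficient sequence and every \<open>n\<close>.\<close>

lemma complex_mgf_zero_free:
  obtains r where "r > 0"
    "\<And>n c l. (\<And>i. \<bar>c i\<bar> \<le> H) \<Longrightarrow> l \<in> ball (of_real l0) r \<Longrightarrow> complex_mgf n c l \<noteq> 0"
proof (cases "0 \<le> H")
  case False
  then show thesis by (intro that[of 1]) (auto dest: order_trans[OF abs_ge_zero])
next
  case H: True
  have q: "card S > 0" using fin s0 by (auto simp: card_gt_0_iff)
  have "0 \<le> F" using f_le[of "\<lambda>_. s0"] s0 by force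
  with H have A: "0 \<le> real m * (H * F)" by simp
  obtain r where r: "r > 0"
    and nz: "\<And>(B :: (nat \<Rightarrow> 's) set) a j l. \<lbrakk>finite B; B \<noteq> {};
      \<And>i b y. b \<in> B \<Longrightarrow> y \<in> B \<Longrightarrow> \<bar>a i b y\<bar> \<le> real m * (H * F); l \<in> ball (of_real l0) r\<rbrakk>
      \<Longrightarrow> (\<Sum>y\<in>B. transfer_iter B (\<lambda>i b y. exp (l * of_real (a i b y))) j y) \<noteq> (0 :: complex)"
    by (rule transfer_iter_exp_nonzero[OF A, of l0]) blast
  have "complex_mgf n c l \<noteq> 0" if c: "\<And>i. \<bar>c i\<bar> \<le> H" and l: "l \<in> ball (of_real l0) r" for n c l
  proof -
    \<comment> \<open>Coefficients cut off at \<open>n\<close> allow the energy over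
      \<open>n\<close> positions to be read as one over \<open>n\<close> full blocks.\<close>
    define c' where "c' i = (if i < n then c i else 0)" for i
    have c': "\<bar>c' i\<bar> \<le> H" for i using c H by (simp add: c'_def)
    have "n + (n * m - n) = n * m" using m by simp
    then have "energy (n * m) c' x = energy n c' x + energy (n * m - n) (\<lambda>i. c' (n + i)) (\<lambda>i. x (n + i))" for x
      using energy_add[of n "n * m - n" c' x] by simp
    then have e: "energy (n * m) c' x = energy n c x" for x by (simp add: energy_def c'_def)
    have "(\<Sum>x\<in>words (n * m + m). exp (l * of_real (energy n c x)))
        = (\<Sum>y\<in>words m. \<Sum>x\<in>words (n * m). exp (l * of_real (energy (n * m) c' (comb_seq (n * m) x y))))"
      unfolding sum_words_add e by (rule sum.swap)
    also have "\<dots> = (\<Sum>y\<in>words m. transfer_iter (words m)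
        (\<lambda>j b y. exp (l * of_real (energy m (\<lambda>i. c' (j * m + i)) (comb_seq m b y)))) n y)"
      by (intro sum.cong refl transfer_iter_eq_sum_words words_subset)
    also have "\<dots> \<noteq> 0"
      by (intro nz finite_words words_nonempty energy_bound comb_seq_in words_subset c' l)
    finally show ?thesis using q by (simp add: complex_mgf_def)
  qed
  with r show thesis by (rule that)
qed

end

section \<open>Existence of the limit and its analyticity\<close>

theorem theorem1p3:
  fixes S :: "'s set"
    and \<Omega> :: "'a::metric_space set" and \<Theta> :: "'a \<Rightarrow> 'a" and h :: "'a \<Rightarrow> real"
    and f :: "(nat \<Rightarrow> 's) \<Rightarrow> real"
  assumes "finite S" and "card S \<ge> 2"
    and "uniquely_ergodic \<Omega> \<Theta>"
    and "continuous_on \<Omega> h"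
    and "depends_on_finitely_many_coordinates S f"
  shows "\<exists>\<phi> :: real \<Rightarrow> real.
    (\<forall>\<omega>\<in>\<Omega>. \<forall>l.
      (\<lambda>n. 1 / real n *
        ln (\<integral>x. exp (l * (\<Sum>k<n. h ((\<Theta> ^^ k) \<omega>) * f ((shift_map ^^ k) x)))
              \<partial>uniform_bernoulli S))
      \<longlonglongrightarrow> \<phi> l) \<and>
    real_analytic \<phi>"
proof (cases "\<Omega> = {}")
  case True
  have "real_analytic (\<lambda>_. 0)"
    unfolding real_analytic_def by (intro allI exI[of _ 1] conjI exI[of _ "\<lambda>_. 0"]) auto
  then show ?thesis using True by (intro exI[of _ "\<lambda>_. 0"]) simp
next
  case False
  then obtain \<omega>0 where \<omega>0: "\<omega>0 \<in> \<Omega>" by auto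
  have \<Omega>: "compact \<Omega>" and \<Theta>: "\<Theta> \<in> \<Omega> \<rightarrow> \<Omega>" "continuous_on \<Omega> \<Theta>"
    using assms(3) by (auto simp: uniquely_ergodic_def)
  have "S \<noteq> {}" using assms(2) by auto
  then obtain s0 where s0: "s0 \<in> S" by auto
  obtain J where J: "finite J"
    "\<And>x y. \<lbrakk>x \<in> UNIV \<rightarrow> S; y \<in> UNIV \<rightarrow> S; \<And>j. j \<in> J \<Longrightarrow> x j = y j\<rbrakk> \<Longrightarrow> f x = f y"
    using assms(5) unfolding depends_on_finitely_many_coordinates_def by metis
  \<comment> \<open>\<open>insert 0\<close> keeps the maximum meaningful for empty \<open>J\<close>,
    and \<open>Suc\<close> makes \<open>m\<close> positive.\<close>
  define m where "m = Suc (Max (insert 0 J))"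
  have Jm: "j < m" if "j \<in> J" for j using J(1) that by (simp add: m_def less_Suc_eq_le)
  have dep: "f x = f y" if "x \<in> UNIV \<rightarrow> S" "y \<in> UNIV \<rightarrow> S" "\<And>i. i < m \<Longrightarrow> x i = y i" for x y
    using that Jm by (intro J(2)) auto
  \<comment> \<open>Finitely many padded words of length \<open>m\<close> already realise every
    value of \<open>f\<close> on the sequence space, so \<open>f\<close> is bounded there.\<close>
  let ?W = "(\<lambda>y k. if k < m then y k else s0) ` ({..<m} \<rightarrow>\<^sub>E S)"
  define F where "F = Max ((\<lambda>x. \<bar>f x\<bar>) ` ?W)"
  have f_le: "\<bar>f x\<bar> \<le> F" if x: "x \<in> UNIV \<rightarrow> S" for x
  proof -
    let ?x = "\<lambda>k. if k < m then restrict x {..<m} k else s0"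
    have W: "?x \<in> ?W" using x by (intro imageI) (simp add: Pi_iff PiE_iff extensional_def)
    have "?x \<in> UNIV \<rightarrow> S" using x s0 by (simp add: Pi_iff)
    then have "f x = f ?x" using x by (intro dep) auto
    moreover have "finite ?W" using assms(1) by (intro finite_imageI finite_PiE) simp_all
    then have "\<bar>f ?x\<bar> \<le> F"
      unfolding F_def by (intro Max_ge[OF finite_imageI imageI[OF W]])
    ultimately show ?thesis by simp
  qed
  have "m > 0" by (simp add: m_def)
  then interpret finite_range_observable S s0 f m F
    by (intro finite_range_observable.intro assms(1) s0 dep f_le)
  have iter: "(\<Theta> ^^ n) \<omega> \<in> \<Omega>" if "\<omega> \<in> \<Omega>" for n \<omega> using that \<Theta>(1) by (induction n) auto
  have iter_cont: "continuous_on \<Omega> (\<Theta> ^^ n)" for n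
  proof (induction n)
    case (Suc n)
    show ?case using continuous_on_compose2[OF \<Theta>(2) Suc.IH] iter by (auto simp: o_def)
  qed simp
  define c where "c \<omega> i = h ((\<Theta> ^^ i) \<omega>)" for \<omega> i
  have "bounded (h ` \<Omega>)" by (intro compact_imp_bounded compact_continuous_image assms(4) \<Omega>)
  then obtain H where "\<And>\<omega>. \<omega> \<in> \<Omega> \<Longrightarrow> \<bar>h \<omega>\<bar> \<le> H" by (auto simp: bounded_iff)
  then have c: "\<bar>c \<omega> i\<bar> \<le> H" if "\<omega> \<in> \<Omega>" for \<omega> i using iter[OF that] by (simp add: c_def)
  have c_cont: "continuous_on \<Omega> (\<lambda>\<omega>. c \<omega> i)" for i
    unfolding c_def using continuous_on_compose2[OF assms(4) iter_cont] iter by auto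
  have c_shift: "c ((\<Theta> ^^ n) \<omega>) = (\<lambda>i. c \<omega> (n + i))" for n \<omega>
    by (simp add: c_def fun_eq_iff add.commute[of n] funpow_add)
  have "\<exists>L. \<forall>\<omega>\<in>\<Omega>. (\<lambda>n. ln (partition_sum l n (c \<omega>)) / real n) \<longlonglongrightarrow> L" for l
  proof (rule almost_additive_limit[OF \<Theta>(1)])
    \<comment> \<open>A fixed partition sum is a finite sum of exponentials in finitely many
      continuous functions of \<omega>, which makes the Birkhoff theorem applicable to its
      logarithm.\<close>
    have cont: "continuous_on \<Omega> (\<lambda>\<omega>. ln (partition_sum l k (c \<omega>)))" for k
    proof (intro continuous_on_ln)
      show "continuous_on \<Omega> (\<lambda>\<omega>. partition_sum l k (c \<omega>))"
        unfolding partition_sum_def energy_def by (intro continuous_intros c_cont)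
    qed (use partition_sum_pos less_irrefl in metis)
    show "\<bar>ln (partition_sum l (n + k) (c \<omega>)) - ln (partition_sum l n (c \<omega>))
        - ln (partition_sum l k (c ((\<Theta> ^^ n) \<omega>)))\<bar> \<le> \<bar>l\<bar> * (2 * real m * (H * F))"
      if "\<omega> \<in> \<Omega>" for n k \<omega>
      unfolding c_shift by (rule partition_sum_almost_additive[OF c[OF that]])
    show "\<exists>D. \<forall>\<omega>\<in>\<Omega>. \<bar>ln (partition_sum l k (c \<omega>))\<bar> \<le> D" for k
      using compact_imp_bounded[OF compact_continuous_image[OF cont[of k] \<Omega>]] by (auto simp: bounded_iff)
    show "\<exists>I. \<forall>\<omega>\<in>\<Omega>. (\<lambda>n. (\<Sum>j<n. ln (partition_sum l k (c ((\<Theta> ^^ j) \<omega>)))) / real n) \<longlonglongrightarrow> I" for k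
      by (rule uniquely_ergodic_birkhoff[OF assms(3) cont])
  qed
  then obtain L where L: "\<And>l \<omega>. \<omega> \<in> \<Omega> \<Longrightarrow> (\<lambda>n. ln (partition_sum l n (c \<omega>)) / real n) \<longlonglongrightarrow> L l"
    by metis
  define \<phi> where "\<phi> l = L l - ln (real (card S))" for l
  have lim: "(\<lambda>n. 1 / real n * ln (\<integral>x. exp (l * energy n (c \<omega>) x) \<partial>uniform_bernoulli S)) \<longlonglongrightarrow> \<phi> l"
    if \<omega>: "\<omega> \<in> \<Omega>" for l \<omega>
  proof -
    let ?C = "\<bar>l\<bar> * (2 * real m * (H * F))"
    let ?I = "\<lambda>n. ln (\<integral>x. exp (l * energy n (c \<omega>) x) \<partial>uniform_bernoulli S)"
    let ?P = "\<lambda>n. ln (partition_sum l n (c \<omega>))"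
    have "(\<lambda>n. 1 / real n * ?I n - (?P n / real n - ln (real (card S)))) \<longlonglongrightarrow> 0"
    proof (rule Lim_null_comparison)
      show "\<forall>\<^sub>F n in sequentially. norm (1 / real n * ?I n - (?P n / real n - ln (real (card S)))) \<le> ?C / real n"
      proof (rule eventually_mono[OF eventually_gt_at_top[of 0]])
        fix n :: nat assume n: "n > 0"
        have "1 / real n * ?I n - (?P n / real n - ln (real (card S)))
            = (?I n - (?P n - real n * ln (real (card S)))) / real n"
          using n by (simp add: diff_divide_distrib)
        then show "norm (1 / real n * ?I n - (?P n / real n - ln (real (card S)))) \<le> ?C / real n"
          using ln_integral_partition_sum[OF c[OF \<omega>], of l n]
          by (simp only: real_norm_def abs_divide abs_of_nat divide_right_mono of_nat_0_le_iff)
      qed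
      show "(\<lambda>n. ?C / real n) \<longlonglongrightarrow> 0"
        by (intro tendsto_divide_0[OF tendsto_const] filterlim_at_top_imp_at_infinity filterlim_real_sequentially)
    qed
    moreover have "(\<lambda>n. ?P n / real n - ln (real (card S))) \<longlonglongrightarrow> \<phi> l"
      unfolding \<phi>_def by (intro tendsto_intros L \<omega>)
    ultimately have "(\<lambda>n. (1 / real n * ?I n - (?P n / real n - ln (real (card S))))
        + (?P n / real n - ln (real (card S)))) \<longlonglongrightarrow> 0 + \<phi> l" by (rule tendsto_add)
    then show ?thesis by simp
  qed
  have "real_analytic \<phi>" unfolding real_analytic_def
  proof
    fix l0
    \<comment> \<open>One base point suffices, because the limit \<phi> is already known to be
      common to all of them.\<close>
    obtain r where r: "r > 0" and nz: "\<And>n l. l \<in> ball (of_real l0) r \<Longrightarrow> complex_mgf n (c \<omega>0) l \<noteq> 0"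
      using complex_mgf_zero_free[of H l0] c[OF \<omega>0] by metis
    show "\<exists>r>0. \<exists>c. \<forall>t. \<bar>t - l0\<bar> < r \<longrightarrow> (\<lambda>n. c n * (t - l0) ^ n) sums \<phi> t"
    proof (rule real_analytic_at_limit_log_norm[OF r complex_mgf_holomorphic nz])
      fix n and l assume "l \<in> ball (complex_of_real l0) r"
      then have "norm l \<le> \<bar>l0\<bar> + r"
        using norm_triangle_sub[of l "of_real l0"] by (simp add: dist_norm norm_minus_commute)
      then show "norm (complex_mgf n (c \<omega>0) l) \<le> exp ((\<bar>l0\<bar> + r) * (H * F) * real n)"
        by (rule norm_complex_mgf_le[OF c[OF \<omega>0]])
    next
      fix x
      \<comment> \<open>At real parameters the generating function is a nonnegative integral, so its
        modulus is the quantity whose logarithm was shown to converge.\<close>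
      have "0 \<le> (\<integral>y. exp (x * energy n (c \<omega>0) y) \<partial>uniform_bernoulli S)" for n
        by (intro Bochner_Integration.integral_nonneg) auto
      then show "(\<lambda>n. 1 / real n * ln (norm (complex_mgf n (c \<omega>0) (of_real x)))) \<longlonglongrightarrow> \<phi> x"
        using lim[OF \<omega>0, of x] by (simp add: complex_mgf_of_real)
    qed
  qed
  with lim show ?thesis unfolding energy_def c_def by blast
qed

end
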